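(* Let $F=\overline{\mathbb{F}}_\ell$ for any prime $\ell$, let $k$ be any local field, and let $D_k$ be the quaternion division algebra over $k$. If $V_1,V_2,V_3$ are three irreducible smooth representations of $D_k^*$ over $F$, then there exists at most one (up to scalar multiples) nonzero $D_k^*$-invariant linear form on $V_1\otimes V_2\otimes V_3$ over $F$; that is, $\dim_F\mathrm{Hom}_{D_k^*}(V_1\otimes_F V_2\otimes_F V_3,\mathrm{triv})\le 1$, where $D_k^*$ acts diagonally on the tensor product and $\mathrm{triv}$ is the trivial representation on $F$.
   Context: A representation of a topological group is smooth if the stabilizer of every vector is open. $D_k^*$ is the multiplicative group of $D_k$ with its natural topology. *)

theory Defs
  imports
    "HOL-Analysis.Analysis"
    "HOL-Library.Function_Algebras"
    "HOL-Library.Poly_Mapping"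
    "HOL-Algebra.Algebraic_Closure_Type"
    "Berlekamp_Zassenhaus.Finite_Field"
begin

section \<open>Local fields\<close>

definition av_topology :: "('k::field \<Rightarrow> real) \<Rightarrow> 'k topology" where
  "av_topology av = Metric_space.mtopology UNIV (\<lambda>x y. av (x - y))"

text \<open>A local field is given by a nontrivial absolute value with locally compact topology; archimedean
  fields and all characteristics are included.\<close>

locale local_field =
  fixes av :: "'k::field \<Rightarrow> real"
  assumes av_nonneg: "0 \<le> av x"
    and av_eq_0_iff: "av x = 0 \<longleftrightarrow> x = 0"
    and av_mult: "av (x * y) = av x * av y"
    and av_triangle: "av (x + y) \<le> av x + av y"
    and av_nontrivial: "\<exists>x. x \<noteq> 0 \<and> av x \<noteq> 1"
    and locally_compact: "locally_compact_space (av_topology av)"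

section \<open>Quaternion division algebras\<close>

text \<open>A quaternion division algebra is a division algebra that is central and of dimension 4 over
  the base field.  The dimension \<^const>\<open>vector_space.dim\<close> is 0 for spaces that are not
  finite-dimensional, so dimension 4 entails finite dimension.\<close>

locale quaternion_division_algebra = vector_space scaleD
  for scaleD :: "'k::field \<Rightarrow> 'd::division_ring \<Rightarrow> 'd" +
  assumes scale_mult_left: "scaleD c x * y = scaleD c (x * y)"
    and scale_mult_right: "x * scaleD c y = scaleD c (x * y)"
    and central: "{z. \<forall>x. z * x = x * z} = (\<lambda>c. scaleD c 1) ` UNIV"
    and dim_4: "vector_space.dim scaleD UNIV = 4"

text \<open>The natural topology of a finite-dimensional vector space over a topological field: the
  product topology transported along the coordinates with respect to a basis.  It does not depend
  on the chosen basis.\<close>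

definition natural_topology ::
    "'k::field topology \<Rightarrow> ('k \<Rightarrow> 'd::ab_group_add \<Rightarrow> 'd) \<Rightarrow> 'd topology" where
  "natural_topology T scaleD =
    (let B = (SOME B. \<not> Modules.module.dependent scaleD B \<and> Modules.module.span scaleD B = UNIV)
     in pullback_topology UNIV (\<lambda>x. \<lambda>b\<in>B. Modules.module.representation scaleD B x b)
          (product_topology (\<lambda>_. T) B))"

text \<open>Inversion is continuous on a finite-dimensional division algebra over a local field, so the
  topology of the multiplicative group is the subspace topology.\<close>

definition mult_group_topology ::
    "('k::field \<Rightarrow> real) \<Rightarrow> ('k \<Rightarrow> 'd::division_ring \<Rightarrow> 'd) \<Rightarrow> 'd topology" where
  "mult_group_topology av scaleD =
    subtopology (natural_topology (av_topology av) scaleD) {x. x \<noteq> 0}"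

section \<open>Representations of the multiplicative group of a division ring\<close>

text \<open>The group is the set of nonzero elements; the value of \<open>\<rho>\<close> at 0 is irrelevant.\<close>

locale mult_group_rep = vector_space scale
  for scale :: "'f::field \<Rightarrow> 'v::ab_group_add \<Rightarrow> 'v" +
  fixes \<rho> :: "'d::division_ring \<Rightarrow> 'v \<Rightarrow> 'v"
  assumes rep_linear: "g \<noteq> 0 \<Longrightarrow> Vector_Spaces.linear scale scale (\<rho> g)"
    and rep_one: "\<rho> 1 v = v"
    and rep_mult: "g \<noteq> 0 \<Longrightarrow> h \<noteq> 0 \<Longrightarrow> \<rho> (g * h) v = \<rho> g (\<rho> h v)"

locale irreducible_mult_group_rep = mult_group_rep scale \<rho>
  for scale :: "'f::field \<Rightarrow> 'v::ab_group_add \<Rightarrow> 'v"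
    and \<rho> :: "'d::division_ring \<Rightarrow> 'v \<Rightarrow> 'v" +
  assumes nontrivial: "\<exists>v::'v. v \<noteq> 0"
    and irreducible: "subspace W \<Longrightarrow> (\<And>g w. g \<noteq> 0 \<Longrightarrow> w \<in> W \<Longrightarrow> \<rho> g w \<in> W)
      \<Longrightarrow> W = {0} \<or> W = UNIV"

definition smooth_rep :: "'d::division_ring topology \<Rightarrow> ('d \<Rightarrow> 'v \<Rightarrow> 'v) \<Rightarrow> bool" where
  "smooth_rep T \<rho> \<longleftrightarrow> (\<forall>v. openin T {g. g \<noteq> 0 \<and> \<rho> g v = v})"

section \<open>The tensor product of three vector spaces\<close>

text \<open>The tensor product is the free vector space on triples of vectors modulo the subspace spanned
  by the multilinearity relations.  Its elements are the equivalence classes, and the operations are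
  lifted from representatives.\<close>

definition free_scale :: "'f::field \<Rightarrow> ('x \<Rightarrow>\<^sub>0 'f) \<Rightarrow> ('x \<Rightarrow>\<^sub>0 'f)" where
  "free_scale c p = Poly_Mapping.map (\<lambda>a. c * a) p"

definition free_map :: "('x \<Rightarrow> 'y) \<Rightarrow> ('x \<Rightarrow>\<^sub>0 'f::field) \<Rightarrow> ('y \<Rightarrow>\<^sub>0 'f)" where
  "free_map f p = (\<Sum>x\<in>Poly_Mapping.keys p. Poly_Mapping.single (f x) (Poly_Mapping.lookup p x))"

locale tensor3 =
  fixes s1 :: "'f::field \<Rightarrow> 'u::ab_group_add \<Rightarrow> 'u"
    and s2 :: "'f \<Rightarrow> 'v::ab_group_add \<Rightarrow> 'v"
    and s3 :: "'f \<Rightarrow> 'w::ab_group_add \<Rightarrow> 'w"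
begin

abbreviation gen :: "'u \<Rightarrow> 'v \<Rightarrow> 'w \<Rightarrow> ('u \<times> 'v \<times> 'w \<Rightarrow>\<^sub>0 'f)" where
  "gen x y z \<equiv> Poly_Mapping.single (x, y, z) 1"

definition relators :: "('u \<times> 'v \<times> 'w \<Rightarrow>\<^sub>0 'f) set" where
  "relators =
     {gen (x + x') y z - gen x y z - gen x' y z | x x' y z. True} \<union>
     {gen x (y + y') z - gen x y z - gen x y' z | x y y' z. True} \<union>
     {gen x y (z + z') - gen x y z - gen x y z' | x y z z'. True} \<union>
     {gen (s1 c x) y z - free_scale c (gen x y z) | c x y z. True} \<union>
     {gen x (s2 c y) z - free_scale c (gen x y z) | c x y z. True} \<union>
     {gen x y (s3 c z) - free_scale c (gen x y z) | c x y z. True}"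

definition tensor_rel :: "('u \<times> 'v \<times> 'w \<Rightarrow>\<^sub>0 'f) rel" where
  "tensor_rel = {(p, q). p - q \<in> Modules.module.span free_scale relators}"

definition tensor :: "('u \<times> 'v \<times> 'w \<Rightarrow>\<^sub>0 'f) set set" where
  "tensor = UNIV // tensor_rel"

definition tensor_add ::
    "('u \<times> 'v \<times> 'w \<Rightarrow>\<^sub>0 'f) set \<Rightarrow> ('u \<times> 'v \<times> 'w \<Rightarrow>\<^sub>0 'f) set \<Rightarrow> ('u \<times> 'v \<times> 'w \<Rightarrow>\<^sub>0 'f) set" where
  "tensor_add A B = (\<Union>p\<in>A. \<Union>q\<in>B. tensor_rel `` {p + q})"

definition tensor_scale ::
    "'f \<Rightarrow> ('u \<times> 'v \<times> 'w \<Rightarrow>\<^sub>0 'f) set \<Rightarrow> ('u \<times> 'v \<times> 'w \<Rightarrow>\<^sub>0 'f) set" where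
  "tensor_scale c A = (\<Union>p\<in>A. tensor_rel `` {free_scale c p})"

definition tensor_map :: "('u \<Rightarrow> 'u) \<Rightarrow> ('v \<Rightarrow> 'v) \<Rightarrow> ('w \<Rightarrow> 'w) \<Rightarrow>
    ('u \<times> 'v \<times> 'w \<Rightarrow>\<^sub>0 'f) set \<Rightarrow> ('u \<times> 'v \<times> 'w \<Rightarrow>\<^sub>0 'f) set" where
  "tensor_map f g h A =
    (\<Union>p\<in>A. tensor_rel `` {free_map (\<lambda>(x, y, z). (f x, g y, h z)) p})"

text \<open>The intertwining maps from the tensor product with diagonal action to the trivial
  representation.  Forms are set to 0 outside the tensor product, so that they are determined by
  their values on it.\<close>

definition invariant_forms ::
    "('d::division_ring \<Rightarrow> 'u \<Rightarrow> 'u) \<Rightarrow> ('d \<Rightarrow> 'v \<Rightarrow> 'v) \<Rightarrow> ('d \<Rightarrow> 'w \<Rightarrow> 'w) \<Rightarrow>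
     (('u \<times> 'v \<times> 'w \<Rightarrow>\<^sub>0 'f) set \<Rightarrow> 'f) set" where
  "invariant_forms \<rho>1 \<rho>2 \<rho>3 = {L.
     (\<forall>A\<in>tensor. \<forall>B\<in>tensor. L (tensor_add A B) = L A + L B) \<and>
     (\<forall>c. \<forall>A\<in>tensor. L (tensor_scale c A) = c * L A) \<and>
     (\<forall>g. g \<noteq> 0 \<longrightarrow> (\<forall>A\<in>tensor. L (tensor_map (\<rho>1 g) (\<rho>2 g) (\<rho>3 g) A) = L A)) \<and>
     (\<forall>A. A \<notin> tensor \<longrightarrow> L A = 0)}"

end

definition form_scale :: "'f::field \<Rightarrow> ('x \<Rightarrow> 'f) \<Rightarrow> ('x \<Rightarrow> 'f)" where
  "form_scale c L = (\<lambda>A. c * L A)"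

end

theory Submission
  imports Defs
begin

text \<open>Since \<open>D\<^sup>*\<close> modulo a central cyclic subgroup is compact, an irreducible smooth
  representation is finitely generated over \<open>F[X, X\<^sup>-\<^sup>1]\<close>; by Nakayama's lemma it is
  finite-dimensional.

  Let \<open>\<sigma>\<close> be the canonical involution of \<open>D\<close>.  If \<open>x\<close> and \<open>y\<close> do not
  commute, then conjugation by \<open>x y - y x\<close> maps the pair \<open>(x, y)\<close> to
  \<open>(\<sigma> x, \<sigma> y)\<close>, and commuting pairs are also simultaneously conjugate to their images.
  Hence \<open>\<sigma>\<close> fixes every double coset of the diagonal in \<open>(D\<^sup>*)\<^sup>3\<close>.  Because
  characters are invariant under \<open>\<sigma>\<close>, each \<open>V\<^sub>i\<close> carries a nondegenerate form for which
  \<open>g\<close> and \<open>\<sigma> g\<close> are adjoint.  These forms turn an invariant form \<open>l'\<close> into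
  an invariant tensor \<open>u'\<close>, and the function \<open>g \<mapsto> l (g u')\<close> on
  \<open>(D\<^sup>*)\<^sup>3\<close> is invariant under the diagonal on both sides, hence under \<open>\<sigma>\<close>.
  This is the Gelfand-Kazhdan argument, and it gives an identity between \<open>l (g u')\<close> and
  \<open>l' (g u)\<close>.  By Burnside's theorem it extends from group elements to all operators, and
  operators of rank one show that \<open>l\<close> and \<open>l'\<close> are proportional.\<close>

section \<open>Operators without eigenvalues on finitely generated modules\<close>

text \<open>Two usual shortcuts fail over this \<open>F\<close>. It is countable, so Schur's lemma
  cannot be had by comparing the dimension of \<open>V\<close> with that of \<open>F(X)\<close>;
  instead, if all \<open>T - a\<close> were bijective, \<open>V\<close> would be a vector space over
  \<open>F(X)\<close>, and a nonzero one is never finitely generated over the Laurent ring. And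
  \<open>\<ell>\<close> may divide the order of finite quotients of the group, so there is neither
  averaging nor complete reducibility: invariant tensors are written down from dual bases, and
  characters enter only through the pairing \<open>tr (A B)\<close> on all operators, which is
  nondegenerate in every characteristic. The number three matters: dividing by the third entry of a
  triple leaves a pair up to conjugation, and a pair is what a single commutator can treat. The base
  field may have characteristic 2 or be archimedean. So the involution is built from the quadratic
  relation of each element without halving, and compactness is proved with coordinates rather than
  with a maximal order.\<close>

locale linear_operator = vector_space scale
  for scale :: "'f::field \<Rightarrow> 'v::ab_group_add \<Rightarrow> 'v" +
  fixes T :: "'v \<Rightarrow> 'v"
  assumes T: "Vector_Spaces.linear scale scale T"
begin

definition poly_act :: "'f poly \<Rightarrow> 'v \<Rightarrow> 'v" where
  "poly_act p = fold_coeffs (\<lambda>a f x. scale a x + T (f x)) p (\<lambda>x. 0)"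

lemma T_add: "T (x + y) = T x + T y" and T_scale: "T (scale c x) = scale c (T x)"
  using T by (simp_all add: Vector_Spaces.linear_iff)

lemma T_zero: "T 0 = 0"
  using T_scale[of 0 0] by simp

lemma poly_act_0 [simp]: "poly_act 0 x = 0"
  by (simp add: poly_act_def)

lemma poly_act_pCons: "poly_act (pCons a p) x = scale a x + T (poly_act p x)"
  by (cases "p = 0 \<and> a = 0") (auto simp: poly_act_def T_zero)

lemma poly_act_linear: "Vector_Spaces.linear scale scale (poly_act p)"
proof (induction p)
  case 0
  then show ?case by (simp add: Vector_Spaces.linear_iff vector_space_axioms)
next
  case (pCons a p)
  then show ?case
    by (auto simp: Vector_Spaces.linear_iff poly_act_pCons T_add T_scale scale_right_distrib mult.commute)
qed

lemma poly_act_sum: "poly_act p (\<Sum>i\<in>I. f i) = (\<Sum>i\<in>I. poly_act p (f i))"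
  using poly_act_linear by (rule module_hom.sum[OF module_hom_linearI])

lemma poly_act_vec_add: "poly_act p (x + y) = poly_act p x + poly_act p y"
  using poly_act_linear by (simp add: Vector_Spaces.linear_iff)

lemma poly_act_vec_scale: "poly_act p (scale c x) = scale c (poly_act p x)"
  using poly_act_linear by (simp add: Vector_Spaces.linear_iff)

lemma poly_act_vec_zero [simp]: "poly_act p 0 = 0"
  using poly_act_vec_scale[of p 0 0] by simp

lemma poly_act_add: "poly_act (p + q) x = poly_act p x + poly_act q x"
  by (induction p q rule: poly_induct2) (auto simp: poly_act_pCons T_add scale_left_distrib)

lemma poly_act_smult: "poly_act (Polynomial.smult c p) x = scale c (poly_act p x)"
  by (induction p) (auto simp: poly_act_pCons scale_right_distrib T_scale)

lemma poly_act_diff: "poly_act (p - q) x = poly_act p x - poly_act q x"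
  using poly_act_add[of "p - q" q x] by simp

lemma poly_act_mult: "poly_act (p * q) x = poly_act p (poly_act q x)"
  by (induction p) (auto simp: poly_act_pCons poly_act_add poly_act_smult mult_pCons_left)

lemma poly_act_monom: "poly_act (Polynomial.monom 1 n) x = (T ^^ n) x"
  by (induction n) (auto simp: monom_0 monom_Suc poly_act_pCons T_zero)

text \<open>Nakayama's lemma for the ideal generated by \<open>X - 1\<close>, proved by eliminating one generator
  at a time: if \<open>s = (X - 1) d x\<close>, then the expansion of \<open>X\<^sup>N d x\<close> in the generators
  shows that \<open>X\<^sup>N - (X - 1) c\<close>, which has value 1 at 1, maps \<open>s\<close> to the span of the others.\<close>

lemma finitely_generated_divisible_zero:
  assumes "finite S" and inv: "\<And>p. p \<noteq> 0 \<Longrightarrow> bij (poly_act p)"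
    and "d \<noteq> 0"
    and "\<And>x. \<exists>n c. poly_act (Polynomial.monom 1 n * d) x = (\<Sum>s\<in>S. poly_act (c s) s)"
  shows "(x :: 'v) = 0"
  using assms(1,3,4)
proof (induction S arbitrary: d rule: finite_induct)
  case empty
  then obtain n where n: "poly_act (Polynomial.monom 1 n * d) x = 0"
    by force
  have "inj (poly_act (Polynomial.monom 1 n * d))"
    using empty inv[of "Polynomial.monom 1 n * d"] by (auto simp: bij_def)
  with n show ?case
    by (metis injD poly_act_vec_zero)
next
  case (insert s S)
  \<comment> \<open>\<open>X\<close> is a unit of the Laurent ring, so the ideal must come from
    another prime; \<open>X - 1\<close> is convenient because every power of \<open>X\<close> has
    value 1 at 1.\<close>
  define Q where "Q = ([:- 1, 1:] :: 'f poly)"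
  have "Q \<noteq> 0"
    by (simp add: Q_def)
  then have "Q * d \<noteq> 0"
    using insert by simp
  then obtain y where y: "poly_act (Q * d) y = s"
    using inv bij_is_surj[of "poly_act (Q * d)"] by (metis surjD)
  obtain n c where nc: "poly_act (Polynomial.monom 1 n * d) y = (\<Sum>s\<in>insert s S. poly_act (c s) s)"
    using insert.prems by blast
  define p where "p = Polynomial.monom 1 n - Q * c s"
  have "poly p 1 = 1"
    by (simp add: p_def Q_def poly_monom)
  then have p0: "p \<noteq> 0"
    by auto
  have "poly_act (Polynomial.monom 1 n) s = poly_act Q (poly_act (Polynomial.monom 1 n * d) y)"
    by (simp add: mult.left_commute flip: y poly_act_mult)
  also have "\<dots> = poly_act (Q * c s) s + (\<Sum>i\<in>S. poly_act (Q * c i) i)"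
    unfolding nc using insert.hyps by (simp add: poly_act_vec_add poly_act_sum poly_act_mult)
  finally have ps: "poly_act p s = (\<Sum>i\<in>S. poly_act (Q * c i) i)"
    by (simp add: p_def poly_act_diff)
  show ?case
  proof (rule insert.IH)
    \<comment> \<open>The common denominator \<open>d\<close> absorbs \<open>p\<close>, which
      rewrites the generator \<open>s\<close> in terms of \<open>S\<close>.\<close>
    show "d * p \<noteq> 0"
      using p0 insert by simp
  next
    fix z
    obtain m e where me: "poly_act (Polynomial.monom 1 m * d) z = (\<Sum>s\<in>insert s S. poly_act (e s) s)"
      using insert.prems by blast
    have "poly_act (Polynomial.monom 1 m * (d * p)) z = poly_act p (poly_act (Polynomial.monom 1 m * d) z)"
      by (simp add: mult_ac flip: poly_act_mult)
    also have "\<dots> = poly_act (e s) (poly_act p s) + (\<Sum>i\<in>S. poly_act (p * e i) i)"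
      unfolding me using insert.hyps
      by (simp add: poly_act_vec_add poly_act_sum mult.commute flip: poly_act_mult)
    also have "\<dots> = (\<Sum>i\<in>S. poly_act (e s * (Q * c i) + p * e i) i)"
      by (simp add: ps poly_act_sum poly_act_add sum.distrib flip: poly_act_mult)
    finally show "\<exists>n c. poly_act (Polynomial.monom 1 n * (d * p)) z = (\<Sum>s\<in>S. poly_act (c s) s)"
      by (intro exI)
  qed
qed

text \<open>Over an algebraically closed field every nonzero polynomial is a constant times linear
  factors, so bijectivity of all shifts makes every nonzero polynomial in \<open>T\<close>
  bijective, and the preceding lemma applies with \<open>d = 1\<close>. The exponent
  \<open>n\<close> in the last hypothesis expresses generation over the Laurent ring without
  inverting \<open>T\<close>.\<close>

lemma ex_not_bij_shift:
  assumes root: "\<And>p :: 'f poly. Polynomial.degree p > 0 \<Longrightarrow> \<exists>a. poly p a = 0"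
    and nontriv: "(v :: 'v) \<noteq> 0"
    and "finite S"
    and gen: "\<And>x. \<exists>n. (T ^^ n) x \<in> span {(T ^^ i) s | i s. s \<in> S}"
  shows "\<exists>a. \<not> bij (\<lambda>x. T x - scale a x)"
proof (rule ccontr)
  assume neg: "\<not> ?thesis"
  have bij: "bij (poly_act p)" if "p \<noteq> 0" for p
    using that
  proof (induction "Polynomial.degree p" arbitrary: p)
    case 0
    then obtain c where c: "p = [:c:]" "c \<noteq> 0"
      by (metis degree_eq_zeroE pCons_eq_0_iff)
    show ?case
      by (rule o_bij[of "scale (inverse c)"]) (auto simp: c poly_act_pCons fun_eq_iff T_zero poly_act_0)
  next
    case (Suc n)
    then obtain a where "poly p a = 0"
      using root[of p] by auto
    then obtain q where q: "p = [:-a, 1:] * q"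
      by (auto simp: poly_eq_0_iff_dvd)
    with Suc have "q \<noteq> 0" by auto
    moreover have "Polynomial.degree p = Suc (Polynomial.degree q)"
      unfolding q using \<open>q \<noteq> 0\<close> by (subst degree_mult_eq) auto
    ultimately have "bij (poly_act q)"
      using Suc by auto
    moreover have "poly_act [:-a, 1:] = (\<lambda>x. T x - scale a x)"
      by (auto simp: poly_act_pCons fun_eq_iff T_zero poly_act_0)
    moreover have "poly_act p = poly_act [:-a, 1:] \<circ> poly_act q"
      unfolding q by (simp only: poly_act_mult fun_eq_iff comp_def simp_thms)
    ultimately show ?case
      using neg by (auto intro: bij_comp)
  qed
  have "v = 0"
  proof (rule finitely_generated_divisible_zero[OF \<open>finite S\<close> bij])
    show "(1::'f poly) \<noteq> 0" by simp
    fix x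
    obtain n where n: "(T ^^ n) x \<in> span {(T ^^ i) s | i s. s \<in> S}"
      using gen by blast
    define M where "M = {y. \<exists>c. y = (\<Sum>s\<in>S. poly_act (c s) s)}"
    have "subspace M"
    proof (rule subspaceI)
      show "0 \<in> M"
        unfolding M_def by (auto intro!: exI[of _ "\<lambda>_. 0"] simp: poly_act_0)
      show "x + y \<in> M" if "x \<in> M" "y \<in> M" for x y
      proof -
        from that obtain c d where "x = (\<Sum>s\<in>S. poly_act (c s) s)" "y = (\<Sum>s\<in>S. poly_act (d s) s)"
          unfolding M_def by auto
        then show ?thesis
          unfolding M_def by (auto intro!: exI[of _ "\<lambda>s. c s + d s"] simp: poly_act_add sum.distrib)
      qed
      show "scale a x \<in> M" if "x \<in> M" for a x
      proof -
        from that obtain c where "x = (\<Sum>s\<in>S. poly_act (c s) s)"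
          unfolding M_def by auto
        then show ?thesis
          unfolding M_def by (auto intro!: exI[of _ "\<lambda>s. Polynomial.smult a (c s)"] simp: poly_act_smult scale_sum_right)
      qed
    qed
    moreover have "{(T ^^ i) s | i s. s \<in> S} \<subseteq> M"
    proof safe
      fix i s assume "s \<in> S"
      then have "(T ^^ i) s = (\<Sum>t\<in>S. poly_act (if t = s then Polynomial.monom 1 i else 0) t)"
        using \<open>finite S\<close>
        by (subst sum.remove[of _ s]) (auto simp: poly_act_monom poly_act_0 intro!: sum.neutral)
      then show "(T ^^ i) s \<in> M"
        unfolding M_def by (intro CollectI exI)
    qed
    ultimately have "(T ^^ n) x \<in> M"
      using n span_minimal by blast
    then show "\<exists>n c. poly_act (Polynomial.monom 1 n * 1) x = (\<Sum>s\<in>S. poly_act (c s) s)"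
      by (auto simp: M_def poly_act_monom)
  qed
  with nontriv show False by simp
qed

end

section \<open>Irreducible representations: Schur, density, Burnside\<close>

lemma linear_sum_scale:
  assumes "Vector_Spaces.linear s t f"
  shows "f (\<Sum>i\<in>I. s (c i) (h i)) = (\<Sum>i\<in>I. t (c i) (f (h i)))"
  using assms by (simp add: module_hom.sum[OF module_hom_linearI[OF assms]] Vector_Spaces.linear_iff)

context mult_group_rep
begin

lemma rep_add: "g \<noteq> 0 \<Longrightarrow> \<rho> g (v + w) = \<rho> g v + \<rho> g w"
  and rep_scale: "g \<noteq> 0 \<Longrightarrow> \<rho> g (scale c v) = scale c (\<rho> g v)"
  using rep_linear[of g] by (simp_all add: Vector_Spaces.linear_iff)

lemma rep_zero [simp]: "g \<noteq> 0 \<Longrightarrow> \<rho> g 0 = 0"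
  using rep_scale[of g 0 0] by simp

lemma rep_inverse_left [simp]: "g \<noteq> 0 \<Longrightarrow> \<rho> (inverse g) (\<rho> g v) = v"
  using rep_mult[of "inverse g" g v] by (simp add: rep_one)

lemma rep_power: "z \<noteq> 0 \<Longrightarrow> \<rho> (z ^ n) v = (\<rho> z ^^ n) v"
  by (induction n) (auto simp: rep_one rep_mult)

text \<open>The image of the group algebra in the endomorphisms of \<open>V\<close>. The inductive
  form turns identities that are linear in an operator into identities about group elements.\<close>

inductive op_alg :: "('v \<Rightarrow> 'v) \<Rightarrow> bool" where
  op_alg_rep: "g \<noteq> 0 \<Longrightarrow> op_alg (\<rho> g)"
| op_alg_add: "op_alg A \<Longrightarrow> op_alg B \<Longrightarrow> op_alg (\<lambda>v. A v + B v)"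
| op_alg_scale: "op_alg A \<Longrightarrow> op_alg (\<lambda>v. scale c (A v))"

lemma op_alg_linear: "op_alg A \<Longrightarrow> Vector_Spaces.linear scale scale A"
proof (induction rule: op_alg.induct)
  case (op_alg_rep g)
  then show ?case by (rule rep_linear)
qed (auto simp: Vector_Spaces.linear_iff vector_space_axioms scale_right_distrib mult.commute)

lemma op_alg_vec_add: "op_alg A \<Longrightarrow> A (v + w) = A v + A w"
  and op_alg_vec_scale: "op_alg A \<Longrightarrow> A (scale c v) = scale c (A v)"
  using op_alg_linear[of A] by (simp_all add: Vector_Spaces.linear_iff)

lemma op_alg_vec_diff: "op_alg A \<Longrightarrow> A (v - w) = A v - A w"
  using op_alg_vec_add[of A "v - w" w] by simp

lemma op_alg_id: "op_alg (\<lambda>v. v)"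
  using op_alg_rep[of 1] by (simp add: rep_one[abs_def])

lemma op_alg_zero: "op_alg (\<lambda>v. 0)"
  using op_alg_scale[OF op_alg_rep[of 1], of 0] by simp

lemma op_alg_diff: "op_alg A \<Longrightarrow> op_alg B \<Longrightarrow> op_alg (\<lambda>v. A v - B v)"
  using op_alg_add[OF _ op_alg_scale[of B "-1"], of A] by simp

lemma op_alg_rep_comp: "op_alg A \<Longrightarrow> g \<noteq> 0 \<Longrightarrow> op_alg (\<lambda>v. \<rho> g (A v))"
proof (induction rule: op_alg.induct)
  case (op_alg_rep h)
  then have "(\<lambda>v. \<rho> g (\<rho> h v)) = \<rho> (g * h)"
    by (simp add: fun_eq_iff rep_mult)
  then show ?case
    using op_alg_rep by (simp add: op_alg.op_alg_rep)
qed (auto simp: rep_add rep_scale intro: op_alg.intros)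

lemma op_alg_sum: "finite I \<Longrightarrow> (\<And>i. i \<in> I \<Longrightarrow> op_alg (A i)) \<Longrightarrow> op_alg (\<lambda>v. \<Sum>i\<in>I. A i v)"
  by (induction I rule: finite_induct) (auto simp: op_alg_zero op_alg_add)

end

locale irreducible_rep_alg_closed = irreducible_mult_group_rep scale \<rho>
  for scale :: "'f::alg_closed_field \<Rightarrow> 'v::ab_group_add \<Rightarrow> 'v"
    and \<rho> :: "'d::division_ring \<Rightarrow> 'v \<Rightarrow> 'v"
begin

text \<open>Schur's lemma with finite generation over the Laurent ring in place of finite dimension.
  Kernel and range of \<open>T - a\<close> are invariant, so irreducibility leaves only bijective or
  zero, and \<open>a\<close> is chosen to exclude the first.\<close>

lemma commuting_operator_scalar:
  assumes T: "Vector_Spaces.linear scale scale T"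
    and comm: "\<And>g v. g \<noteq> 0 \<Longrightarrow> T (\<rho> g v) = \<rho> g (T v)"
    and S: "finite S" "\<And>x. \<exists>n. (T ^^ n) x \<in> span {(T ^^ i) s | i s. s \<in> S}"
  shows "\<exists>a. \<forall>x. T x = scale a x"
proof -
  interpret T: linear_operator scale T
    by (intro linear_operator.intro linear_operator_axioms.intro vector_space_axioms T)
  obtain v :: 'v where "v \<noteq> 0"
    using nontrivial by blast
  then obtain a where a: "\<not> bij (\<lambda>x. T x - scale a x)"
    using T.ex_not_bij_shift[OF _ _ S] alg_closed_imp_poly_has_root by blast
  define U where "U x = T x - scale a x" for x
  have U_add: "U (x + y) = U x + U y" and U_scale: "U (scale c x) = scale c (U x)" for x y c
    by (simp_all add: U_def T.T_add T.T_scale scale_right_distrib scale_right_diff_distrib mult.commute)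
  have U_0: "U 0 = 0"
    using U_scale[of 0 0] by simp
  have U_rep: "U (\<rho> g x) = \<rho> g (U x)" if "g \<noteq> 0" for g x
    using that rep_add[of g "T x - scale a x" "scale a x"] by (simp add: U_def comm rep_scale algebra_simps)
  have "{x. U x = 0} = {0} \<or> {x. U x = 0} = UNIV"
    by (rule irreducible) (auto intro!: subspaceI simp: U_add U_scale U_0 U_rep)
  moreover have "range U = {0} \<or> range U = UNIV"
  proof (rule irreducible)
    show "subspace (range U)"
    proof (rule subspaceI)
      show "0 \<in> range U" using U_0 by (metis rangeI)
      show "x + y \<in> range U" if "x \<in> range U" "y \<in> range U" for x y
        using that by (auto simp flip: U_add)
      show "scale c x \<in> range U" if "x \<in> range U" for x c
        using that by (auto simp flip: U_scale)
    qed
    show "\<rho> g w \<in> range U" if "g \<noteq> 0" "w \<in> range U" for g w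
      using that by (auto simp flip: U_rep)
  qed
  moreover have "bij U" if "{x. U x = 0} = {0}" "range U = UNIV"
  proof -
    have "inj U"
    proof (rule injI)
      fix x y assume "U x = U y"
      then have "U (x - y) = 0"
        using U_add[of "x - y" y] by simp
      then have "x - y = 0"
        using that by blast
      then show "x = y" by simp
    qed
    with that show ?thesis by (simp add: bij_def)
  qed
  ultimately have "\<forall>x. U x = 0"
    using a unfolding U_def[abs_def] by blast
  then show ?thesis
    by (auto simp: U_def)
qed

section \<open>Finite dimension from compactness modulo a central element\<close>

lemma span_orbit:
  assumes "v \<noteq> 0"
  shows "span {\<rho> g v | g. g \<noteq> 0} = UNIV"
proof -
  let ?O = "{\<rho> g v | g. g \<noteq> 0}"
  have "\<rho> g w \<in> span ?O" if "g \<noteq> 0" "w \<in> span ?O" for g w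
    using that(2)
  proof (induction rule: span_induct_alt)
    case base
    then show ?case using that by (simp add: span_zero)
  next
    case (step c x y)
    then obtain h where h: "x = \<rho> h v" "h \<noteq> 0" by auto
    then have "\<rho> g x = \<rho> (g * h) v" "g * h \<noteq> 0"
      using that by (simp_all add: rep_mult)
    then have "\<rho> g x \<in> span ?O"
      by (intro span_base) auto
    then show ?case
      using step that by (simp add: rep_add rep_scale span_add span_scale)
  qed
  then have "span ?O = {0} \<or> span ?O = UNIV"
    by (intro irreducible) auto
  moreover have "v \<in> span ?O"
    by (rule span_base) (auto intro!: exI[of _ 1] simp: rep_one)
  ultimately show ?thesis
    using assms by auto
qed

text \<open>Up to powers of \<open>z\<close>, the orbit of \<open>v\<close> is the finite set of all
  \<open>\<rho> s v\<close>, so \<open>V\<close> is finitely generated over the Laurent ring in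
  \<open>\<rho> z\<close>. Then the central operator \<open>\<rho> z\<close> is a scalar, powers of
  \<open>z\<close> no longer enlarge spans, and the finite set alone spans \<open>V\<close>. Two
  natural exponents replace one integer exponent.\<close>

lemma finite_dimensional_of_cocompact:
  assumes z: "z \<noteq> 0" "\<And>g. z * g = g * z"
    and S: "finite S" "0 \<notin> S"
    and v: "v \<noteq> 0"
    and cover: "\<And>g. g \<noteq> 0 \<Longrightarrow>
      \<exists>n m s u. s \<in> S \<and> u \<noteq> 0 \<and> \<rho> u v = v \<and> z ^ n * g = z ^ m * s * u"
  shows "\<exists>S. finite S \<and> span S = UNIV"
proof -
  let ?T = "\<rho> z"
  define S' where "S' = (\<lambda>s. \<rho> s v) ` S"
  have key: "\<exists>n m. \<exists>s\<in>S'. (?T ^^ n) (\<rho> g v) = (?T ^^ m) s" if "g \<noteq> 0" for g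
  proof -
    obtain n m s u where *: "s \<in> S" "u \<noteq> 0" "\<rho> u v = v" "z ^ n * g = z ^ m * s * u"
      using cover \<open>g \<noteq> 0\<close> by blast
    have "s \<noteq> 0" using * S by auto
    have "(?T ^^ n) (\<rho> g v) = \<rho> (z ^ n * g) v"
      using z that by (simp add: rep_mult rep_power)
    also have "\<dots> = (?T ^^ m) (\<rho> s v)"
      using z * \<open>s \<noteq> 0\<close> by (simp add: rep_mult rep_power)
    finally show ?thesis
      using * unfolding S'_def by blast
  qed
  define P where "P = span {(?T ^^ i) s | i s. s \<in> S'}"
  have TP: "?T x \<in> P" if "x \<in> P" for x
    using that unfolding P_def
  proof (induction rule: span_induct_alt)
    case base
    then show ?case using z by (simp add: span_zero)
  next
    case (step c x y)
    then obtain i s where "x = (?T ^^ i) s" "s \<in> S'" by auto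
    then have "?T x = (?T ^^ Suc i) s" by simp
    then have "?T x \<in> span {(?T ^^ i) s | i s. s \<in> S'}"
      using \<open>s \<in> S'\<close> by (intro span_base CollectI exI conjI)
    then show ?case
      using step z by (simp add: rep_add rep_scale span_add span_scale)
  qed
  have TPn: "(?T ^^ n) x \<in> P" if "x \<in> P" for x n
    using that by (induction n) (auto simp: TP)
  have Tn_add: "(?T ^^ n) (x + y) = (?T ^^ n) x + (?T ^^ n) y"
    and Tn_scale: "(?T ^^ n) (scale c x) = scale c ((?T ^^ n) x)" for n x y c
    using z by (simp_all add: rep_add rep_scale flip: rep_power)
  have gen: "\<exists>n. (?T ^^ n) x \<in> P" for x
  proof -
    let ?W = "{x. \<exists>n. (?T ^^ n) x \<in> P}"
    have "x \<in> span {\<rho> g v | g. g \<noteq> 0}"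
      using span_orbit[OF v] by simp
    also have "\<dots> \<subseteq> ?W"
    proof (rule span_minimal)
      show "{\<rho> g v | g. g \<noteq> 0} \<subseteq> ?W"
      proof safe
        fix g :: 'd assume "g \<noteq> 0"
        from key[OF this] obtain n m s where "s \<in> S'" "(?T ^^ n) (\<rho> g v) = (?T ^^ m) s"
          by blast
        moreover have "(?T ^^ m) s \<in> P"
          using \<open>s \<in> S'\<close> unfolding P_def by (blast intro: span_base)
        ultimately show "\<exists>n. (?T ^^ n) (\<rho> g v) \<in> P"
          by metis
      qed
      show "subspace ?W"
      proof (rule subspaceI)
        show "0 \<in> ?W"
          by (auto simp: P_def span_zero intro!: exI[of _ 0])
        show "x + y \<in> ?W" if xy: "x \<in> ?W" "y \<in> ?W" for x y
        proof -
          from xy obtain n m where "(?T ^^ n) x \<in> P" "(?T ^^ m) y \<in> P" by auto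
          then have "(?T ^^ m) ((?T ^^ n) x) + (?T ^^ n) ((?T ^^ m) y) \<in> P"
            using TPn span_add unfolding P_def by blast
          also have "(?T ^^ m) ((?T ^^ n) x) = (?T ^^ (n + m)) x"
            by (simp add: add.commute[of n m] funpow_add)
          also have "(?T ^^ n) ((?T ^^ m) y) = (?T ^^ (n + m)) y"
            by (simp add: funpow_add)
          finally have "(?T ^^ (n + m)) (x + y) \<in> P"
            by (simp only: Tn_add)
          then show ?thesis by blast
        qed
        show "scale c x \<in> ?W" if "x \<in> ?W" for c x
        proof -
          from that obtain n where "(?T ^^ n) x \<in> P" by auto
          then have "(?T ^^ n) (scale c x) \<in> P"
            unfolding Tn_scale P_def by (rule span_scale)
          then show ?thesis by blast
        qed
      qed
    qed
    finally show ?thesis by simp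
  qed
  have "?T (\<rho> g x) = \<rho> g (?T x)" if "g \<noteq> 0" for g x
    using rep_mult[OF z(1) that, of x] rep_mult[OF that z(1), of x] z(2)[of g] by simp
  then have "\<exists>a. \<forall>x. ?T x = scale a x"
    using gen S unfolding P_def
    by (intro commuting_operator_scalar[OF rep_linear[OF z(1)], of S']) (auto simp: S'_def)
  then obtain a where a: "\<And>x. ?T x = scale a x"
    by blast
  have "a \<noteq> 0"
  proof
    assume "a = 0"
    then have "\<rho> z v = 0" using a by simp
    then have "v = 0" using rep_inverse_left[OF z(1), of v] z by simp
    with v show False by simp
  qed
  have Tn: "(?T ^^ n) x = scale (a ^ n) x" for n x
    by (induction n) (auto simp: a)
  have "span {\<rho> g v | g. g \<noteq> 0} \<subseteq> span S'"
  proof (rule span_minimal)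
    show "{\<rho> g v | g. g \<noteq> 0} \<subseteq> span S'"
    proof safe
      fix g :: 'd assume "g \<noteq> 0"
      from key[OF this] obtain n m s where *: "s \<in> S'" "(?T ^^ n) (\<rho> g v) = (?T ^^ m) s"
        by blast
      have "scale (a ^ n) (\<rho> g v) \<in> span S'"
        using *(2) span_scale[OF span_base[OF *(1)]] by (simp add: Tn)
      then have "scale (inverse (a ^ n)) (scale (a ^ n) (\<rho> g v)) \<in> span S'"
        by (rule span_scale)
      then show "\<rho> g v \<in> span S'"
        using \<open>a \<noteq> 0\<close> by simp
    qed
  qed simp
  then have "span S' = UNIV"
    using span_orbit[OF v] by auto
  moreover have "finite S'"
    using S by (simp add: S'_def)
  ultimately show ?thesis by blast
qed

end

locale fd_irreducible_rep = irreducible_rep_alg_closed scale \<rho>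
  for scale :: "'f::alg_closed_field \<Rightarrow> 'v::ab_group_add \<Rightarrow> 'v"
    and \<rho> :: "'d::division_ring \<Rightarrow> 'v \<Rightarrow> 'v" +
  assumes finite_dim: "\<exists>S. finite S \<and> span S = UNIV"
begin

lemma schur:
  assumes "Vector_Spaces.linear scale scale T"
    and "\<And>g v. g \<noteq> 0 \<Longrightarrow> T (\<rho> g v) = \<rho> g (T v)"
  shows "\<exists>a. \<forall>x. T x = scale a x"
proof -
  obtain S where S: "finite S" "span S = UNIV"
    using finite_dim by blast
  have "S \<subseteq> {(T ^^ i) s | i s. s \<in> S}"
  proof
    fix s assume "s \<in> S"
    then have "s = (T ^^ 0) s \<and> s \<in> S"
      by simp
    then show "s \<in> {(T ^^ i) s | i s. s \<in> S}"
      by blast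
  qed
  then have "span S \<subseteq> span {(T ^^ i) s | i s. s \<in> S}"
    by (rule span_mono)
  then have "\<exists>n. (T ^^ n) x \<in> span {(T ^^ i) s | i s. s \<in> S}" for x
    using S by (intro exI[of _ 0]) auto
  then show ?thesis
    using commuting_operator_scalar assms S by blast
qed

section \<open>Density and Burnside's theorem\<close>

lemma op_alg_transitive:
  assumes "v \<noteq> 0"
  shows "\<exists>A. op_alg A \<and> A v = w"
proof -
  let ?W = "{w. \<exists>A. op_alg A \<and> A v = w}"
  have "?W = {0} \<or> ?W = UNIV"
  proof (rule irreducible)
    show "subspace ?W"
      by (rule subspaceI) (auto intro: op_alg_zero op_alg_add op_alg_scale)
    show "\<rho> g x \<in> ?W" if "g \<noteq> 0" "x \<in> ?W" for g x
      using that op_alg_rep_comp by blast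
  qed
  moreover have "v \<in> ?W"
    using op_alg_id by blast
  ultimately have "?W = UNIV"
    using assms by auto
  then show ?thesis by blast
qed

lemma op_alg_kills_span:
  assumes "op_alg A" "\<And>s. s \<in> S \<Longrightarrow> A s = 0" "x \<in> span S"
  shows "A x = 0"
  using assms(3)
proof (induction rule: span_induct_alt)
  case base
  then show ?case using op_alg_vec_scale[OF assms(1), of 0 0] by simp
next
  case (step c x y)
  then show ?case using assms by (simp add: op_alg_vec_add op_alg_vec_scale)
qed

text \<open>Let \<open>I\<close> be the left ideal of operators killing \<open>S\<close>. If
  everything in \<open>I\<close> that kills \<open>s\<close> also killed \<open>v\<close>, then
  \<open>A s \<mapsto> A v\<close> for \<open>A\<close> in \<open>I\<close> would be a well-defined
  intertwiner of \<open>V\<close>, hence a scalar \<open>a\<close>. So \<open>I\<close> kills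
  \<open>v - a s\<close>, and the induction hypothesis puts this vector into the span of
  \<open>S\<close>.\<close>

lemma jacobson_density:
  assumes "finite S" "v \<notin> span S"
  shows "\<exists>A. op_alg A \<and> (\<forall>s\<in>S. A s = 0) \<and> A v \<noteq> 0"
  using assms
proof (induction S arbitrary: v rule: finite_induct)
  case empty
  then show ?case
    by (intro exI[of _ "\<lambda>v. v"]) (auto simp: op_alg_id)
next
  case (insert s S)
  show ?case
  proof (cases "s \<in> span S")
    case True
    then have "span (insert s S) = span S"
      by (rule span_redundant)
    then show ?thesis
      using insert True op_alg_kills_span by (metis insert_iff)
  next
    case False
    define I where "I A \<longleftrightarrow> op_alg A \<and> (\<forall>s\<in>S. A s = 0)" for A
    have I_add: "I (\<lambda>v. A v + B v)" and I_diff: "I (\<lambda>v. A v - B v)" if "I A" "I B" for A B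
      using that by (auto simp: I_def op_alg_add op_alg_diff)
    have I_scale: "I (\<lambda>v. scale c (A v))" if "I A" for A c
      using that by (auto simp: I_def op_alg_scale)
    have I_rep: "I (\<lambda>v. \<rho> g (A v))" if "I A" "g \<noteq> 0" for A g
      using that by (auto simp: I_def op_alg_rep_comp)
    have I_0: "I (\<lambda>v. 0)"
      by (auto simp: I_def op_alg_zero)
    show ?thesis
    proof (rule ccontr)
      assume neg: "\<not> ?thesis"
      have kill: "A v = 0" if "I A" "A s = 0" for A
        using neg that unfolding I_def by blast
      let ?W = "{w. \<exists>A. I A \<and> A s = w}"
      have "?W = {0} \<or> ?W = UNIV"
      proof (rule irreducible)
        show "subspace ?W"
          by (rule subspaceI) (auto intro: I_0 I_add I_scale)
        show "\<rho> g x \<in> ?W" if "g \<noteq> 0" "x \<in> ?W" for g x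
          using that I_rep by blast
      qed
      moreover obtain A0 where "I A0" "A0 s \<noteq> 0"
        using insert.IH[OF False] unfolding I_def by blast
      ultimately have "?W = UNIV" by blast
      then have ex: "\<exists>A. I A \<and> A s = w" for w by blast
      define \<Phi> where "\<Phi> w = (SOME A. I A \<and> A s = w) v" for w
      have \<Phi>: "\<Phi> (A s) = A v" if "I A" for A
      proof -
        define B where "B = (SOME B. I B \<and> B s = A s)"
        have B: "I B" "B s = A s"
          unfolding B_def using someI_ex[OF ex[of "A s"]] by auto
        have "(\<lambda>v. B v - A v) v = 0"
          by (rule kill[OF I_diff[OF B(1) that]]) (simp add: B)
        then show ?thesis
          by (simp add: \<Phi>_def flip: B_def)
      qed
      have "Vector_Spaces.linear scale scale \<Phi>"
        unfolding Vector_Spaces.linear_iff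
      proof (intro conjI allI vector_space_axioms)
        fix x y c
        obtain A B where A: "I A" "A s = x" and B: "I B" "B s = y"
          using ex by meson
        show "\<Phi> (x + y) = \<Phi> x + \<Phi> y"
          using \<Phi>[OF I_add[OF A(1) B(1)]] \<Phi>[OF A(1)] \<Phi>[OF B(1)] A B by simp
        show "\<Phi> (scale c x) = scale c (\<Phi> x)"
          using \<Phi>[OF I_scale[OF A(1)]] \<Phi>[OF A(1)] A by simp
      qed
      moreover have "\<Phi> (\<rho> g x) = \<rho> g (\<Phi> x)" if "g \<noteq> 0" for g x
      proof -
        obtain A where A: "I A" "A s = x"
          using ex by meson
        show ?thesis
          using \<Phi>[OF I_rep[OF A(1) that]] \<Phi>[OF A(1)] A by simp
      qed
      ultimately have "\<exists>a. \<forall>x. \<Phi> x = scale a x"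
        by (rule schur)
      then obtain a where a: "\<And>x. \<Phi> x = scale a x"
        by blast
      have "A (v - scale a s) = 0" if "op_alg A" "\<forall>s\<in>S. A s = 0" for A
        using \<Phi>[of A] that by (simp add: a I_def op_alg_vec_diff op_alg_vec_scale)
      then have "v - scale a s \<in> span S"
        using insert.IH[of "v - scale a s"] by metis
      then have "v \<in> span (insert s S)"
        using span_breakdown_eq by blast
      with insert.prems show False by blast
    qed
  qed
qed

definition bas :: "'v set" where
  "bas = (SOME S. finite S \<and> independent S \<and> span S = UNIV)"

lemma bas: "finite bas" "independent bas" "span bas = UNIV"
proof -
  obtain S where S: "finite S" "span S = UNIV"
    using finite_dim by blast
  obtain B where B: "B \<subseteq> S" "independent B" "span B = span S"
    using maximal_independent_subset[of S]
    by (metis span_mono span_span subset_antisym)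
  then have "finite B \<and> independent B \<and> span B = UNIV"
    using S finite_subset by auto
  then have "finite bas \<and> independent bas \<and> span bas = UNIV"
    unfolding bas_def by (rule someI)
  then show "finite bas" "independent bas" "span bas = UNIV" by auto
qed

definition co :: "'v \<Rightarrow> 'v \<Rightarrow> 'f" where
  "co b v = representation bas v b"

lemma co_add: "co b (v + w) = co b v + co b w"
  and co_scale: "co b (scale c v) = c * co b v"
  by (simp_all add: co_def representation_add representation_scale bas)

lemma co_zero [simp]: "co b 0 = 0"
  by (simp add: co_def representation_zero)

lemma co_bas: "b \<in> bas \<Longrightarrow> b' \<in> bas \<Longrightarrow> co b b' = (if b' = b then 1 else 0)"
  by (simp add: co_def representation_basis bas)

lemma sum_co: "(\<Sum>b\<in>bas. scale (co b v) b) = v"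
  unfolding co_def by (rule sum_representation_eq) (auto simp: bas)

lemma co_eq_zero_imp: "(\<And>b. b \<in> bas \<Longrightarrow> co b v = 0) \<Longrightarrow> v = 0"
  using sum_co[of v] by simp

lemma linear_eq_on_bas:
  assumes "Vector_Spaces.linear scale s f" "Vector_Spaces.linear scale s g"
    and "\<And>b. b \<in> bas \<Longrightarrow> f b = g b"
  shows "f v = g v"
proof -
  have "f (\<Sum>b\<in>bas. scale (co b v) b) = g (\<Sum>b\<in>bas. scale (co b v) b)"
    by (simp add: linear_sum_scale[OF assms(1)] linear_sum_scale[OF assms(2)] assms(3))
  then show ?thesis by (simp add: sum_co)
qed

text \<open>Density yields an operator that kills all basis vectors but one, transitivity moves the
  surviving value to the prescribed one, and these operators are summed over the basis.\<close>

lemma burnside: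
  assumes A: "Vector_Spaces.linear scale scale A"
  shows "op_alg A"
proof -
  have "\<exists>D. op_alg D \<and> (\<forall>b'\<in>bas. D b' = (if b' = b then A b else 0))" if b: "b \<in> bas" for b
  proof -
    have "b \<notin> span (bas - {b})"
      using bas b by (auto simp: dependent_def)
    then obtain E where E: "op_alg E" "\<forall>s\<in>bas - {b}. E s = 0" "E b \<noteq> 0"
      using jacobson_density[of "bas - {b}" b] bas by auto
    obtain C where C: "op_alg C" "C (E b) = A b"
      using op_alg_transitive[OF E(3)] by blast
    have "op_alg (\<lambda>v. C (E v))"
      using C(1)
    proof (induction rule: op_alg.induct)
      case (op_alg_rep g)
      then show ?case using E op_alg_rep_comp by blast
    qed (auto intro: op_alg.intros)
    moreover have "C 0 = 0"
      using op_alg_vec_scale[OF C(1), of 0 0] by simp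
    ultimately show ?thesis
      using E C by (intro exI[of _ "\<lambda>v. C (E v)"]) auto
  qed
  then obtain D where D: "\<And>b. b \<in> bas \<Longrightarrow> op_alg (D b)"
    "\<And>b b'. b \<in> bas \<Longrightarrow> b' \<in> bas \<Longrightarrow> D b b' = (if b' = b then A b else 0)"
    by metis
  have sum: "op_alg (\<lambda>v. \<Sum>b\<in>bas. D b v)"
    using D bas by (intro op_alg_sum) auto
  have "(\<Sum>b\<in>bas. D b v) = A v" for v
  proof (rule linear_eq_on_bas[OF op_alg_linear[OF sum] A])
    fix b assume "b \<in> bas"
    then show "(\<Sum>c\<in>bas. D c b) = A b"
      using bas by (simp add: D)
  qed
  with sum show ?thesis by simp
qed

end

section \<open>Invariant bilinear forms\<close>

text \<open>All that the representation theory uses of the quaternion algebra.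
  \<open>bar_triple\<close> says that \<open>bar\<close> fixes every double coset of the diagonal in
  the product of three copies of the group.\<close>

locale conjugating_involution =
  fixes bar :: "'d::division_ring \<Rightarrow> 'd"
  assumes bar_mult: "bar (x * y) = bar y * bar x"
    and bar_bar [simp]: "bar (bar x) = x"
    and bar_0 [simp]: "bar 0 = 0"
    and bar_triple: "g1 \<noteq> 0 \<Longrightarrow> g2 \<noteq> 0 \<Longrightarrow> g3 \<noteq> 0 \<Longrightarrow>
      \<exists>x y. x \<noteq> 0 \<and> y \<noteq> 0 \<and> x * g1 * y = bar g1 \<and> x * g2 * y = bar g2 \<and> x * g3 * y = bar g3"
begin

lemma bar_eq_0_iff [simp]: "bar x = 0 \<longleftrightarrow> x = 0"
  by (metis bar_bar bar_0)

lemma bar_1 [simp]: "bar 1 = 1"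
  by (metis bar_bar bar_mult mult_1_right mult_1_left)

lemma bar_conjugate: "g \<noteq> 0 \<Longrightarrow> \<exists>x. x \<noteq> 0 \<and> bar g = x * g * inverse x"
proof -
  assume "g \<noteq> 0"
  then obtain x y where "x \<noteq> 0" "y \<noteq> 0" "x * 1 * y = bar 1" "x * g * y = bar g"
    using bar_triple[of 1 g g] by auto
  then show ?thesis
    by (metis bar_1 inverse_unique mult_1_right)
qed

end

locale fd_rep_involution = fd_irreducible_rep scale \<rho> + conjugating_involution bar
  for scale :: "'f::alg_closed_field \<Rightarrow> 'v::ab_group_add \<Rightarrow> 'v"
    and \<rho> :: "'d::division_ring \<Rightarrow> 'v \<Rightarrow> 'v"
    and bar :: "'d \<Rightarrow> 'd"
begin

text \<open>A relation rather than a map: an operator can be written in many ways as a combination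
  of group elements, and it is not clear beforehand that applying \<open>bar\<close> to each of them
  gives a result independent of the expression.\<close>

inductive adj :: "('v \<Rightarrow> 'v) \<Rightarrow> ('v \<Rightarrow> 'v) \<Rightarrow> bool" where
  adj_rep: "g \<noteq> 0 \<Longrightarrow> adj (\<rho> g) (\<rho> (bar g))"
| adj_add: "adj A A' \<Longrightarrow> adj B B' \<Longrightarrow> adj (\<lambda>v. A v + B v) (\<lambda>v. A' v + B' v)"
| adj_scale: "adj A A' \<Longrightarrow> adj (\<lambda>v. scale c (A v)) (\<lambda>v. scale c (A' v))"

lemma adj_sym: "adj A A' \<Longrightarrow> adj A' A"
proof (induction rule: adj.induct)
  case (adj_rep g)
  then show ?case using adj.adj_rep[of "bar g"] by simp
qed (auto intro: adj.intros)

lemma adj_op_alg: "adj A A' \<Longrightarrow> op_alg A"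
  by (induction rule: adj.induct) (auto intro: op_alg.intros)

lemma adj_ex:
  assumes "Vector_Spaces.linear scale scale A"
  shows "\<exists>A'. adj A A'"
proof -
  have "op_alg A" using assms by (rule burnside)
  then show ?thesis
    by (induction rule: op_alg.induct) (blast intro: adj.intros)+
qed

lemma adj_diff: "adj A A' \<Longrightarrow> adj B B' \<Longrightarrow> adj (\<lambda>v. A v - B v) (\<lambda>v. A' v - B' v)"
  using adj_add[OF _ adj_scale[of B B' "-1"], of A A'] by simp

lemma adj_rep_comp: "adj A A' \<Longrightarrow> g \<noteq> 0 \<Longrightarrow> adj (\<lambda>v. \<rho> g (A v)) (\<lambda>v. A' (\<rho> (bar g) v))"
proof (induction rule: adj.induct)
  case (adj_rep h)
  then have "(\<lambda>v. \<rho> g (\<rho> h v)) = \<rho> (g * h)" "(\<lambda>v. \<rho> (bar h) (\<rho> (bar g) v)) = \<rho> (bar (g * h))"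
    by (simp_all add: fun_eq_iff rep_mult bar_mult)
  then show ?case
    using adj_rep adj.adj_rep[of "g * h"] by simp
qed (auto simp: rep_add rep_scale intro: adj.intros)

section \<open>The trace pairing and uniqueness of adjoints\<close>

definition tr :: "('v \<Rightarrow> 'v) \<Rightarrow> 'f" where
  "tr A = (\<Sum>b\<in>bas. co b (A b))"

lemma tr_add: "tr (\<lambda>v. A v + B v) = tr A + tr B"
  and tr_scale: "tr (\<lambda>v. scale c (A v)) = c * tr A"
  by (simp_all add: tr_def co_add co_scale sum.distrib sum_distrib_left)

lemma co_linear: "Vector_Spaces.linear scale (*) (co b)"
  unfolding co_def using bas by (intro linear_representation)

lemma tr_comm:
  assumes "Vector_Spaces.linear scale scale A" "Vector_Spaces.linear scale scale B"
  shows "tr (\<lambda>v. A (B v)) = tr (\<lambda>v. B (A v))"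
proof -
  have *: "tr (\<lambda>v. A (B v)) = (\<Sum>b\<in>bas. \<Sum>c\<in>bas. co c (B b) * co b (A c))"
    if "Vector_Spaces.linear scale scale A" for A B
    unfolding tr_def
  proof (rule sum.cong[OF refl])
    fix b
    have "co b (A (B b)) = co b (A (\<Sum>c\<in>bas. scale (co c (B b)) c))"
      by (simp add: sum_co)
    then show "co b (A (B b)) = (\<Sum>c\<in>bas. co c (B b) * co b (A c))"
      by (simp only: linear_sum_scale[OF that] linear_sum_scale[OF co_linear])
  qed
  show ?thesis
    unfolding *[OF assms(1)] *[OF assms(2)] by (subst sum.swap) (simp add: mult.commute)
qed

lemma tr_bar: "g \<noteq> 0 \<Longrightarrow> tr (\<rho> (bar g)) = tr (\<rho> g)"
proof -
  assume g: "g \<noteq> 0"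
  then obtain x where x: "x \<noteq> 0" "bar g = x * g * inverse x"
    using bar_conjugate by blast
  have "\<rho> (bar g) = (\<lambda>v. \<rho> x (\<rho> (g * inverse x) v))"
    using x g by (simp add: fun_eq_iff mult.assoc flip: rep_mult)
  then have "tr (\<rho> (bar g)) = tr (\<lambda>v. \<rho> x (\<rho> (g * inverse x) v))"
    by simp
  also have "\<dots> = tr (\<lambda>v. \<rho> (g * inverse x) (\<rho> x v))"
    using x g by (intro tr_comm rep_linear) auto
  also have "(\<lambda>v. \<rho> (g * inverse x) (\<rho> x v)) = \<rho> g"
    using x g by (simp add: fun_eq_iff mult.assoc flip: rep_mult)
  finally show ?thesis .
qed

text \<open>Characters are invariant under \<open>bar\<close>, and the trace form on operators is nondegenerate,
  so \<open>bar\<close> descends from the group algebra to its image in the operators.\<close>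

lemma adj_zero:
  assumes "adj (\<lambda>v. 0) A'"
  shows "A' v = 0"
proof -
  \<comment> \<open>Linear extension of the invariance of characters, applied to the product
    \<open>g * h\<close>.\<close>
  have *: "tr (\<lambda>v. A (\<rho> h v)) = tr (\<lambda>v. \<rho> (bar h) (A' v))" if "adj A A'" "h \<noteq> 0" for A A' h
    using that
  proof (induction rule: adj.induct)
    case (adj_rep g)
    then have "(\<lambda>v. \<rho> g (\<rho> h v)) = \<rho> (g * h)" "(\<lambda>v. \<rho> (bar h) (\<rho> (bar g) v)) = \<rho> (bar (g * h))"
      by (simp_all add: fun_eq_iff rep_mult bar_mult)
    then show ?case
      using adj_rep by (simp add: tr_bar)
  qed (simp_all add: tr_add tr_scale rep_add rep_scale)
  have "tr (\<lambda>v. E (A' v)) = 0" if "op_alg E" for E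
    using that
  proof (induction rule: op_alg.induct)
    case (op_alg_rep g)
    then show ?case using *[OF assms, of "bar g"] by (simp add: tr_def)
  qed (simp_all add: tr_add tr_scale)
  \<comment> \<open>Pairing \<open>A'\<close> with a rank one operator reads off one coordinate of
    \<open>A' v\<close>; by Burnside's theorem this operator lies in the image of the group
    algebra.\<close>
  moreover have "Vector_Spaces.linear scale scale (\<lambda>x. scale (co b x) v)" for b
    by (simp add: Vector_Spaces.linear_iff vector_space_axioms co_add co_scale scale_left_distrib)
  ultimately have "tr (\<lambda>x. scale (co b (A' x)) v) = 0" for b
    using burnside by blast
  moreover have "tr (\<lambda>x. scale (co b (A' x)) v) = co b (A' v)" for b
  proof -
    have A': "Vector_Spaces.linear scale scale A'"
      using adj_op_alg[OF adj_sym[OF assms]] by (rule op_alg_linear)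
    have "co b (A' v) = co b (A' (\<Sum>c\<in>bas. scale (co c v) c))"
      by (simp add: sum_co)
    also have "\<dots> = (\<Sum>c\<in>bas. co c v * co b (A' c))"
      by (simp only: linear_sum_scale[OF A'] linear_sum_scale[OF co_linear])
    also have "\<dots> = tr (\<lambda>x. scale (co b (A' x)) v)"
      by (simp add: tr_def co_scale mult.commute)
    finally show ?thesis ..
  qed
  ultimately show ?thesis
    by (intro co_eq_zero_imp) auto
qed

lemma adj_unique:
  assumes "adj A A'" "adj A A''"
  shows "A' = A''"
proof
  fix v
  have "adj (\<lambda>v. 0) (\<lambda>v. A' v - A'' v)"
    using adj_diff[OF assms] by simp
  from adj_zero[OF this, of v] show "A' v = A'' v" by simp
qed

definition adjoint :: "('v \<Rightarrow> 'v) \<Rightarrow> ('v \<Rightarrow> 'v)" where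
  "adjoint A = (THE A'. adj A A')"

lemma adjoint_eqI: "adj A A' \<Longrightarrow> adjoint A = A'"
  unfolding adjoint_def using adj_unique by blast

text \<open>The rank one operators \<open>E v\<close> with a fixed functional \<open>co a\<close>
  form a left ideal isomorphic to \<open>V\<close>. Passing to adjoints turns left multiplication by
  \<open>\<rho> g\<close> into right multiplication by \<open>\<rho> (bar g)\<close>, so any
  coordinate of \<open>adjoint (E v) w\<close> is an invariant form in \<open>v\<close> and
  \<open>w\<close>; the coordinate \<open>b\<close> is chosen to make it nonzero.\<close>

lemma ex_invariant_form:
  "\<exists>B. (\<forall>v. Vector_Spaces.linear scale (*) (B v)) \<and> (\<forall>w. Vector_Spaces.linear scale (*) (\<lambda>v. B v w)) \<and>
     (\<forall>g v w. g \<noteq> 0 \<longrightarrow> B (\<rho> g v) w = B v (\<rho> (bar g) w)) \<and> (\<exists>v w. B v w \<noteq> 0)"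
proof -
  obtain v0 :: 'v where v0: "v0 \<noteq> 0"
    using nontrivial by blast
  then obtain a where a: "a \<in> bas"
    using co_eq_zero_imp by blast
  define E where "E v = (\<lambda>w. scale (co a w) v)" for v
  have E_lin: "Vector_Spaces.linear scale scale (E v)" for v
    by (simp add: E_def Vector_Spaces.linear_iff vector_space_axioms co_add co_scale scale_left_distrib)
  have adj_X: "adj (E v) (adjoint (E v))" for v
    using adj_ex[OF E_lin[of v]] adjoint_eqI by metis
  have E_add: "adjoint (E (v + v')) w = adjoint (E v) w + adjoint (E v') w" for v v' w
    using adjoint_eqI[OF adj_add[OF adj_X[of v] adj_X[of v']]]
    by (simp add: E_def scale_right_distrib)
  have E_scale: "adjoint (E (scale c v)) w = scale c (adjoint (E v) w)" for v c w
    using adjoint_eqI[OF adj_scale[OF adj_X[of v], of c]]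
    by (simp add: E_def mult.commute)
  have E_rep: "adjoint (E (\<rho> g v)) w = adjoint (E v) (\<rho> (bar g) w)" if "g \<noteq> 0" for v g w
    using adjoint_eqI[OF adj_rep_comp[OF adj_X[of v] that]] that
    by (simp add: E_def rep_scale)
  have "\<exists>w. adjoint (E v0) w \<noteq> 0"
  proof (rule ccontr)
    assume "\<not> ?thesis"
    then have "adjoint (E v0) = (\<lambda>w. 0)" by auto
    with adj_sym[OF adj_X[of v0]] have "adj (\<lambda>w. 0) (E v0)" by simp
    from adj_zero[OF this, of a] have "v0 = 0"
      using a by (simp add: E_def co_bas)
    with v0 show False by simp
  qed
  then obtain w b where wb: "co b (adjoint (E v0) w) \<noteq> 0"
    using co_eq_zero_imp by blast
  have lin: "Vector_Spaces.linear scale scale (adjoint (E v))" for v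
    using adj_op_alg[OF adj_sym[OF adj_X]] by (rule op_alg_linear)
  show ?thesis
  proof (intro exI[of _ "\<lambda>v w. co b (adjoint (E v) w)"] conjI allI impI)
    fix v w
    show "Vector_Spaces.linear scale (*) (\<lambda>w. co b (adjoint (E v) w))"
      using Vector_Spaces.linear_compose[OF lin[of v] co_linear[of b]] by (simp add: comp_def)
    show "Vector_Spaces.linear scale (*) (\<lambda>v. co b (adjoint (E v) w))"
      using co_linear[of b]
      by (auto simp: Vector_Spaces.linear_iff vector_space_axioms E_add E_scale)
    show "\<exists>v w. co b (adjoint (E v) w) \<noteq> 0"
      using wb by blast
    show "co b (adjoint (E (\<rho> g v)) w) = co b (adjoint (E v) (\<rho> (bar g) w))" if "g \<noteq> 0" for g
      using E_rep[OF that] by simp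
  qed
qed

text \<open>The family \<open>(a, h a)\<close> is a pair of dual bases for an invariant form, so that
  \<open>\<Sum> a \<otimes> h a\<close> corresponds to the identity operator.\<close>

definition adjoint_family :: "('v \<Rightarrow> 'v) \<Rightarrow> bool" where
  "adjoint_family h \<longleftrightarrow>
     (\<forall>g m m'. g \<noteq> 0 \<longrightarrow> Vector_Spaces.linear scale (*) m \<longrightarrow> Vector_Spaces.linear scale (*) m' \<longrightarrow>
        (\<Sum>a\<in>bas. m (\<rho> g a) * m' (h a)) = (\<Sum>a\<in>bas. m a * m' (\<rho> (bar g) (h a)))) \<and>
     (\<forall>p. \<exists>f. Vector_Spaces.linear scale (*) f \<and> p = (\<Sum>a\<in>bas. scale (f a) (h a)))"

lemma adjoint_family_shift:
  assumes "adjoint_family h" "g \<noteq> 0"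
    and "Vector_Spaces.linear scale (*) m" "Vector_Spaces.linear scale (*) m'"
  shows "(\<Sum>a\<in>bas. m (\<rho> g a) * m' (h a)) = (\<Sum>a\<in>bas. m a * m' (\<rho> (bar g) (h a)))"
  using assms by (simp add: adjoint_family_def)

lemma adjoint_family_spans:
  "adjoint_family h \<Longrightarrow> \<exists>f. Vector_Spaces.linear scale (*) f \<and> p = (\<Sum>a\<in>bas. scale (f a) (h a))"
  by (simp add: adjoint_family_def)

text \<open>The radical of the form is an invariant subspace, hence zero. That each
  \<open>co a\<close> is represented by a vector \<open>h a\<close> comes from adjoints: with
  \<open>B v0 w0 = 1\<close>, the adjoint of \<open>w \<mapsto> co a w \<cdot> w0\<close> sends
  \<open>v0\<close> to such a vector.\<close>

lemma ex_adjoint_family: "\<exists>h. adjoint_family h"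
proof -
  obtain B where B_lin: "\<And>v. Vector_Spaces.linear scale (*) (B v)"
      "\<And>w. Vector_Spaces.linear scale (*) (\<lambda>v. B v w)"
    and B_rep: "\<And>g v w. g \<noteq> 0 \<Longrightarrow> B (\<rho> g v) w = B v (\<rho> (bar g) w)"
    and B_ne: "\<exists>v w. B v w \<noteq> 0"
    using ex_invariant_form by metis
  have B_add: "B (x + y) w = B x w + B y w" "B w (x + y) = B w x + B w y"
    and B_scale: "B (scale c x) w = c * B x w" "B w (scale c x) = c * B w x" for x y w c
    using B_lin by (simp_all add: Vector_Spaces.linear_iff)
  have B_0: "B 0 w = 0" for w
    using B_scale(1)[of 0 0 w] by simp
  have B_adj: "B v (A w) = B (A' v) w" if "adj A A'" for A A' v w
    using that
  proof (induction rule: adj.induct)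
    case (adj_rep g)
    then show ?case using B_rep[of "bar g" v w] by simp
  qed (simp_all add: B_add B_scale)
  have nondeg: "v = v'" if "\<And>w. B v w = B v' w" for v v'
  proof -
    let ?W = "{v. \<forall>w. B v w = 0}"
    have "?W = {0} \<or> ?W = UNIV"
      by (rule irreducible) (auto intro!: subspaceI simp: B_0 B_add B_scale B_rep)
    then have "?W = {0}"
      using B_ne by blast
    moreover have "v - v' \<in> ?W"
      using that B_add(1)[of "v - v'" v'] by simp
    ultimately show "v = v'" by simp
  qed
  obtain v0 w0 where vw: "B v0 w0 = 1"
  proof -
    obtain v w where "B v w \<noteq> 0" using B_ne by blast
    then have "B v (scale (inverse (B v w)) w) = 1"
      by (simp add: B_scale)
    then show ?thesis using that by blast
  qed
  have "\<exists>u. \<forall>w. B u w = co a w" for a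
  proof -
    have "Vector_Spaces.linear scale scale (\<lambda>w. scale (co a w) w0)"
      by (simp add: Vector_Spaces.linear_iff vector_space_axioms co_add co_scale scale_left_distrib)
    then obtain A' where "adj (\<lambda>w. scale (co a w) w0) A'"
      using adj_ex by blast
    from B_adj[OF this, of v0] show ?thesis
      by (intro exI[of _ "A' v0"]) (simp add: B_scale vw)
  qed
  then obtain h where h: "\<And>a w. B (h a) w = co a w"
    by metis
  have expand: "p = (\<Sum>a\<in>bas. scale (B p a) (h a))" for p
  proof (rule nondeg)
    fix w
    have "B p w = B p (\<Sum>a\<in>bas. scale (co a w) a)"
      by (simp add: sum_co)
    also have "\<dots> = (\<Sum>a\<in>bas. B p a * B (h a) w)"
      by (simp only: linear_sum_scale[OF B_lin(1)] h mult.commute)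
    also have "\<dots> = B (\<Sum>a\<in>bas. scale (B p a) (h a)) w"
      by (simp only: linear_sum_scale[OF B_lin(2)])
    finally show "B p w = B (\<Sum>a\<in>bas. scale (B p a) (h a)) w" .
  qed
  show ?thesis
    unfolding adjoint_family_def
  proof (intro exI[of _ h] conjI allI impI)
    fix g :: 'd and m m' :: "'v \<Rightarrow> 'f"
    assume g: "g \<noteq> 0" and m: "Vector_Spaces.linear scale (*) m" and m': "Vector_Spaces.linear scale (*) m'"
    \<comment> \<open>The matrix entries of \<open>\<rho> g\<close> are
      \<open>co c (\<rho> g a) = B (\<rho> (bar g) (h c)) a\<close>, which are also the coefficients
      of \<open>\<rho> (bar g) (h c)\<close> in the family \<open>h\<close>.\<close>
    have "(\<Sum>a\<in>bas. m (\<rho> g a) * m' (h a)) = (\<Sum>a\<in>bas. \<Sum>c\<in>bas. B (\<rho> (bar g) (h c)) a * m c * m' (h a))"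
    proof (rule sum.cong[OF refl])
      fix a
      have "m (\<rho> g a) = m (\<Sum>c\<in>bas. scale (co c (\<rho> g a)) c)"
        by (simp add: sum_co)
      also have "\<dots> = (\<Sum>c\<in>bas. B (\<rho> (bar g) (h c)) a * m c)"
        using B_rep[of "bar g" _ a] g by (simp add: linear_sum_scale[OF m] flip: h)
      finally show "m (\<rho> g a) * m' (h a) = (\<Sum>c\<in>bas. B (\<rho> (bar g) (h c)) a * m c * m' (h a))"
        by (simp add: sum_distrib_right)
    qed
    also have "\<dots> = (\<Sum>c\<in>bas. \<Sum>a\<in>bas. B (\<rho> (bar g) (h c)) a * m c * m' (h a))"
      by (rule sum.swap)
    also have "\<dots> = (\<Sum>c\<in>bas. m c * m' (\<rho> (bar g) (h c)))"
    proof (rule sum.cong[OF refl])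
      fix c
      have "m' (\<rho> (bar g) (h c)) = m' (\<Sum>a\<in>bas. scale (B (\<rho> (bar g) (h c)) a) (h a))"
        by (simp flip: expand)
      also have "\<dots> = (\<Sum>a\<in>bas. B (\<rho> (bar g) (h c)) a * m' (h a))"
        by (rule linear_sum_scale[OF m'])
      finally show "(\<Sum>a\<in>bas. B (\<rho> (bar g) (h c)) a * m c * m' (h a)) = m c * m' (\<rho> (bar g) (h c))"
        by (simp add: sum_distrib_left mult_ac)
    qed
    finally show "(\<Sum>a\<in>bas. m (\<rho> g a) * m' (h a)) = (\<Sum>a\<in>bas. m a * m' (\<rho> (bar g) (h a)))" .
  next
    fix p
    show "\<exists>f. Vector_Spaces.linear scale (*) f \<and> p = (\<Sum>a\<in>bas. scale (f a) (h a))"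
      using B_lin(1)[of p] expand[of p] by blast
  qed
qed

end

section \<open>Invariant trilinear forms\<close>

definition trilinear where
  "trilinear s1 s2 s3 l \<longleftrightarrow>
     (\<forall>y z. Vector_Spaces.linear s1 (*) (\<lambda>x. l x y z)) \<and>
     (\<forall>x z. Vector_Spaces.linear s2 (*) (\<lambda>y. l x y z)) \<and>
     (\<forall>x y. Vector_Spaces.linear s3 (*) (\<lambda>z. l x y z))"

locale three_fd_reps_involution =
  V1: fd_rep_involution s1 \<rho>1 bar + V2: fd_rep_involution s2 \<rho>2 bar + V3: fd_rep_involution s3 \<rho>3 bar
  for s1 :: "'f::alg_closed_field \<Rightarrow> 'u::ab_group_add \<Rightarrow> 'u" and \<rho>1 :: "'d::division_ring \<Rightarrow> 'u \<Rightarrow> 'u"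
    and s2 :: "'f \<Rightarrow> 'v::ab_group_add \<Rightarrow> 'v" and \<rho>2 :: "'d \<Rightarrow> 'v \<Rightarrow> 'v"
    and s3 :: "'f \<Rightarrow> 'w::ab_group_add \<Rightarrow> 'w" and \<rho>3 :: "'d \<Rightarrow> 'w \<Rightarrow> 'w"
    and bar :: "'d \<Rightarrow> 'd"
begin

abbreviation tri :: "('u \<Rightarrow> 'v \<Rightarrow> 'w \<Rightarrow> 'f) \<Rightarrow> bool" where
  "tri \<equiv> trilinear s1 s2 s3"

lemma tri_iff:
  "tri l \<longleftrightarrow>
     (\<forall>x x' y z. l (x + x') y z = l x y z + l x' y z) \<and> (\<forall>c x y z. l (s1 c x) y z = c * l x y z) \<and>
     (\<forall>x y y' z. l x (y + y') z = l x y z + l x y' z) \<and> (\<forall>c x y z. l x (s2 c y) z = c * l x y z) \<and>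
     (\<forall>x y z z'. l x y (z + z') = l x y z + l x y z') \<and> (\<forall>c x y z. l x y (s3 c z) = c * l x y z)"
proof -
  have "vector_space ((*) :: 'f \<Rightarrow> 'f \<Rightarrow> 'f)"
    by unfold_locales (simp_all add: algebra_simps)
  then show ?thesis
    unfolding trilinear_def Vector_Spaces.linear_iff
    using V1.vector_space_axioms V2.vector_space_axioms V3.vector_space_axioms
    by (intro iffI conjI allI) simp_all
qed

lemma invariant_forms_proportional:
  assumes l: "tri l" and l': "tri l'"
    and l_inv: "\<And>g x y z. g \<noteq> 0 \<Longrightarrow> l (\<rho>1 g x) (\<rho>2 g y) (\<rho>3 g z) = l x y z"
    and l'_inv: "\<And>g x y z. g \<noteq> 0 \<Longrightarrow> l' (\<rho>1 g x) (\<rho>2 g y) (\<rho>3 g z) = l' x y z"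
    and ne: "l' p1 p2 p3 \<noteq> 0"
  shows "\<exists>c. \<forall>x y z. l x y z = c * l' x y z"
proof -
  obtain h1 h2 h3 where h: "V1.adjoint_family h1" "V2.adjoint_family h2" "V3.adjoint_family h3"
    using V1.ex_adjoint_family V2.ex_adjoint_family V3.ex_adjoint_family by blast
  \<comment> \<open>The dual basis identity used in one factor after another; the swaps bring the
    relevant sum to the innermost place.\<close>
  have shift: "(\<Sum>a\<in>V1.bas. \<Sum>b\<in>V2.bas. \<Sum>c\<in>V3.bas. m (\<rho>1 g1 a) (\<rho>2 g2 b) (\<rho>3 g3 c) * m' (h1 a) (h2 b) (h3 c)) =
    (\<Sum>a\<in>V1.bas. \<Sum>b\<in>V2.bas. \<Sum>c\<in>V3.bas. m a b c * m' (\<rho>1 (bar g1) (h1 a)) (\<rho>2 (bar g2) (h2 b)) (\<rho>3 (bar g3) (h3 c)))"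
    if m: "tri m" "tri m'" and g: "g1 \<noteq> 0" "g2 \<noteq> 0" "g3 \<noteq> 0" for m m' g1 g2 g3
  proof -
    have lin1: "Vector_Spaces.linear s1 (*) (\<lambda>x. m x y z)" "Vector_Spaces.linear s1 (*) (\<lambda>x. m' x y z)" for y z
      using m by (simp_all add: trilinear_def)
    have lin2: "Vector_Spaces.linear s2 (*) (\<lambda>y. m x y z)" "Vector_Spaces.linear s2 (*) (\<lambda>y. m' x y z)" for x z
      using m by (simp_all add: trilinear_def)
    have lin3: "Vector_Spaces.linear s3 (*) (\<lambda>z. m x y z)" "Vector_Spaces.linear s3 (*) (\<lambda>z. m' x y z)" for x y
      using m by (simp_all add: trilinear_def)
    have "(\<Sum>a\<in>V1.bas. \<Sum>b\<in>V2.bas. \<Sum>c\<in>V3.bas. m (\<rho>1 g1 a) (\<rho>2 g2 b) (\<rho>3 g3 c) * m' (h1 a) (h2 b) (h3 c)) =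
       (\<Sum>a\<in>V1.bas. \<Sum>b\<in>V2.bas. \<Sum>c\<in>V3.bas. m (\<rho>1 g1 a) (\<rho>2 g2 b) c * m' (h1 a) (h2 b) (\<rho>3 (bar g3) (h3 c)))"
      by (intro sum.cong refl V3.adjoint_family_shift[OF h(3) g(3) lin3])
    also have "\<dots> = (\<Sum>a\<in>V1.bas. \<Sum>c\<in>V3.bas. \<Sum>b\<in>V2.bas. m (\<rho>1 g1 a) (\<rho>2 g2 b) c * m' (h1 a) (h2 b) (\<rho>3 (bar g3) (h3 c)))"
      by (intro sum.cong refl sum.swap)
    also have "\<dots> = (\<Sum>a\<in>V1.bas. \<Sum>c\<in>V3.bas. \<Sum>b\<in>V2.bas. m (\<rho>1 g1 a) b c * m' (h1 a) (\<rho>2 (bar g2) (h2 b)) (\<rho>3 (bar g3) (h3 c)))"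
      by (intro sum.cong refl V2.adjoint_family_shift[OF h(2) g(2) lin2])
    also have "\<dots> = (\<Sum>a\<in>V1.bas. \<Sum>b\<in>V2.bas. \<Sum>c\<in>V3.bas. m (\<rho>1 g1 a) b c * m' (h1 a) (\<rho>2 (bar g2) (h2 b)) (\<rho>3 (bar g3) (h3 c)))"
      by (intro sum.cong refl sum.swap)
    also have "\<dots> = (\<Sum>b\<in>V2.bas. \<Sum>a\<in>V1.bas. \<Sum>c\<in>V3.bas. m (\<rho>1 g1 a) b c * m' (h1 a) (\<rho>2 (bar g2) (h2 b)) (\<rho>3 (bar g3) (h3 c)))"
      by (rule sum.swap)
    also have "\<dots> = (\<Sum>b\<in>V2.bas. \<Sum>c\<in>V3.bas. \<Sum>a\<in>V1.bas. m (\<rho>1 g1 a) b c * m' (h1 a) (\<rho>2 (bar g2) (h2 b)) (\<rho>3 (bar g3) (h3 c)))"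
      by (intro sum.cong refl sum.swap)
    also have "\<dots> = (\<Sum>b\<in>V2.bas. \<Sum>c\<in>V3.bas. \<Sum>a\<in>V1.bas. m a b c * m' (\<rho>1 (bar g1) (h1 a)) (\<rho>2 (bar g2) (h2 b)) (\<rho>3 (bar g3) (h3 c)))"
      by (intro sum.cong refl V1.adjoint_family_shift[OF h(1) g(1) lin1])
    also have "\<dots> = (\<Sum>b\<in>V2.bas. \<Sum>a\<in>V1.bas. \<Sum>c\<in>V3.bas. m a b c * m' (\<rho>1 (bar g1) (h1 a)) (\<rho>2 (bar g2) (h2 b)) (\<rho>3 (bar g3) (h3 c)))"
      by (intro sum.cong refl sum.swap)
    also have "\<dots> = (\<Sum>a\<in>V1.bas. \<Sum>b\<in>V2.bas. \<Sum>c\<in>V3.bas. m a b c * m' (\<rho>1 (bar g1) (h1 a)) (\<rho>2 (bar g2) (h2 b)) (\<rho>3 (bar g3) (h3 c)))"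
      by (rule sum.swap)
    finally show ?thesis .
  qed
  \<comment> \<open>These are \<open>l (g u')\<close> and \<open>l' (g u)\<close> with arbitrary
    operators in place of \<open>g\<close>, where \<open>u'\<close> has coefficients
    \<open>l' (h1 a) (h2 b) (h3 c)\<close> on the tensors of basis vectors, and \<open>u\<close> has
    coefficients \<open>l a b c\<close> on the tensors of dual vectors.\<close>
  define \<phi> where "\<phi> A B C = (\<Sum>a\<in>V1.bas. \<Sum>b\<in>V2.bas. \<Sum>c\<in>V3.bas. l (A a) (B b) (C c) * l' (h1 a) (h2 b) (h3 c))" for A B C
  define \<psi> where "\<psi> A B C = (\<Sum>a\<in>V1.bas. \<Sum>b\<in>V2.bas. \<Sum>c\<in>V3.bas. l a b c * l' (A (h1 a)) (B (h2 b)) (C (h3 c)))" for A B C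
  have tri_rep: "tri (\<lambda>a b c. l (\<rho>1 g1 a) (\<rho>2 g2 b) (\<rho>3 g3 c))" if "g1 \<noteq> 0" "g2 \<noteq> 0" "g3 \<noteq> 0" for g1 g2 g3
    using l that unfolding tri_iff
    by (simp add: V1.rep_add V1.rep_scale V2.rep_add V2.rep_scale V3.rep_add V3.rep_scale)
  txt \<open>The matrix coefficient \<open>\<phi>\<close> is invariant under the diagonal subgroup on both sides, hence
    under \<open>bar\<close>.\<close>
  have group: "\<phi> (\<rho>1 g1) (\<rho>2 g2) (\<rho>3 g3) = \<psi> (\<rho>1 g1) (\<rho>2 g2) (\<rho>3 g3)"
    if g: "g1 \<noteq> 0" "g2 \<noteq> 0" "g3 \<noteq> 0" for g1 g2 g3
  proof -
    obtain x y where xy: "x \<noteq> 0" "y \<noteq> 0" "x * g1 * y = bar g1" "x * g2 * y = bar g2" "x * g3 * y = bar g3"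
      using V1.bar_triple[OF g] by blast
    have bar_rep: "\<rho>1 (bar g1) v1 = \<rho>1 x (\<rho>1 g1 (\<rho>1 y v1))" "\<rho>2 (bar g2) v2 = \<rho>2 x (\<rho>2 g2 (\<rho>2 y v2))"
      "\<rho>3 (bar g3) v3 = \<rho>3 x (\<rho>3 g3 (\<rho>3 y v3))" for v1 v2 v3
      using xy g by (simp_all add: V1.rep_mult V2.rep_mult V3.rep_mult flip: xy(3-5))
    \<comment> \<open>Moving the operators from one side to the other costs a \<open>bar\<close>,
      which the double coset relation replaces by \<open>x\<close> and \<open>y\<close>. The form
      \<open>l\<close> absorbs \<open>x\<close>; \<open>y\<close> is shifted onto the dual vectors
      as \<open>bar y\<close> and absorbed by \<open>l'\<close>.\<close>
    have "\<psi> (\<rho>1 g1) (\<rho>2 g2) (\<rho>3 g3) = \<phi> (\<rho>1 (bar g1)) (\<rho>2 (bar g2)) (\<rho>3 (bar g3))"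
      unfolding \<phi>_def \<psi>_def using shift[OF l l', of "bar g1" "bar g2" "bar g3"] g by simp
    also have "\<dots> = (\<Sum>a\<in>V1.bas. \<Sum>b\<in>V2.bas. \<Sum>c\<in>V3.bas.
        l (\<rho>1 g1 (\<rho>1 y a)) (\<rho>2 g2 (\<rho>2 y b)) (\<rho>3 g3 (\<rho>3 y c)) * l' (h1 a) (h2 b) (h3 c))"
      unfolding \<phi>_def by (simp only: bar_rep l_inv[OF xy(1)])
    also have "\<dots> = \<phi> (\<rho>1 g1) (\<rho>2 g2) (\<rho>3 g3)"
      unfolding \<phi>_def shift[OF tri_rep[OF g] l' xy(2) xy(2) xy(2)]
      using xy(2) by (simp add: l'_inv)
    finally show ?thesis ..
  qed
  \<comment> \<open>Both sides are linear in each operator separately, so the extension from group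
    elements goes slot by slot.\<close>
  have ops: "\<phi> A B C = \<psi> A B C" if "V1.op_alg A" "V2.op_alg B" "V3.op_alg C" for A B C
    using that(3)
  proof (induction rule: V3.op_alg.induct)
    case (op_alg_rep g3)
    note g3 = this
    show ?case
      using that(2)
    proof (induction rule: V2.op_alg.induct)
      case (op_alg_rep g2)
      note g2 = this
      show ?case
        using that(1)
      proof (induction rule: V1.op_alg.induct)
        case (op_alg_rep g1)
        then show ?case using group g2 g3 by blast
      next
        case (op_alg_add A B)
        then show ?case
          using l l' by (simp add: \<phi>_def \<psi>_def tri_iff sum.distrib algebra_simps)
      next
        case (op_alg_scale A c)
        then show ?case
          using l l' by (simp add: \<phi>_def \<psi>_def tri_iff mult.assoc mult.left_commute[of _ c] flip: sum_distrib_left)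
      qed
    next
      case (op_alg_add A B)
      then show ?case
        using l l' by (simp add: \<phi>_def \<psi>_def tri_iff sum.distrib algebra_simps)
    next
      case (op_alg_scale A c)
      then show ?case
        using l l' by (simp add: \<phi>_def \<psi>_def tri_iff mult.assoc mult.left_commute[of _ c] flip: sum_distrib_left)
    qed
  next
    case (op_alg_add A B)
    then show ?case
      using l l' by (simp add: \<phi>_def \<psi>_def tri_iff sum.distrib algebra_simps)
  next
    case (op_alg_scale A c)
    then show ?case
      using l l' by (simp add: \<phi>_def \<psi>_def tri_iff mult.assoc mult.left_commute[of _ c] flip: sum_distrib_left)
  qed
  \<comment> \<open>The functionals expand the \<open>p\<close>s in the dual families, so that
    inserting \<open>v \<mapsto> f v \<cdot> x\<close> and its analogues collapses \<phi> to
    \<open>l x y z\<close> times the nonzero number \<open>l' p1 p2 p3\<close>.\<close>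
  obtain f1 where f1: "Vector_Spaces.linear s1 (*) f1" "p1 = (\<Sum>a\<in>V1.bas. s1 (f1 a) (h1 a))"
    using V1.adjoint_family_spans[OF h(1)] by blast
  obtain f2 where f2: "Vector_Spaces.linear s2 (*) f2" "p2 = (\<Sum>a\<in>V2.bas. s2 (f2 a) (h2 a))"
    using V2.adjoint_family_spans[OF h(2)] by blast
  obtain f3 where f3: "Vector_Spaces.linear s3 (*) f3" "p3 = (\<Sum>a\<in>V3.bas. s3 (f3 a) (h3 a))"
    using V3.adjoint_family_spans[OF h(3)] by blast
  have p: "l' p1 p2 p3 = (\<Sum>a\<in>V1.bas. \<Sum>b\<in>V2.bas. \<Sum>c\<in>V3.bas. f1 a * (f2 b * (f3 c * l' (h1 a) (h2 b) (h3 c))))"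
  proof -
    have "l' p1 p2 p3 = (\<Sum>a\<in>V1.bas. f1 a * l' (h1 a) p2 p3)"
      unfolding f1(2) using l' by (intro linear_sum_scale) (simp add: trilinear_def)
    also have "\<dots> = (\<Sum>a\<in>V1.bas. f1 a * (\<Sum>b\<in>V2.bas. f2 b * l' (h1 a) (h2 b) p3))"
      unfolding f2(2) using l' by (intro sum.cong refl arg_cong2[of _ _ _ _ "(*)"] linear_sum_scale) (simp add: trilinear_def)
    also have "\<dots> = (\<Sum>a\<in>V1.bas. f1 a * (\<Sum>b\<in>V2.bas. f2 b * (\<Sum>c\<in>V3.bas. f3 c * l' (h1 a) (h2 b) (h3 c))))"
      unfolding f3(2) using l' by (intro sum.cong refl arg_cong2[of _ _ _ _ "(*)"] linear_sum_scale) (simp add: trilinear_def)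
    finally show ?thesis
      by (simp add: sum_distrib_left)
  qed
  \<comment> \<open>The same operators collapse \<psi> to \<open>l' x y z\<close> times this
    constant, which does not depend on \<open>x\<close>, \<open>y\<close>, \<open>z\<close>.\<close>
  define K where "K = (\<Sum>a\<in>V1.bas. \<Sum>b\<in>V2.bas. \<Sum>c\<in>V3.bas. l a b c * (f1 (h1 a) * (f2 (h2 b) * f3 (h3 c))))"
  have "l x y z * l' p1 p2 p3 = l' x y z * K" for x y z
  proof -
    have "\<phi> (\<lambda>v. s1 (f1 v) x) (\<lambda>v. s2 (f2 v) y) (\<lambda>v. s3 (f3 v) z) =
          \<psi> (\<lambda>v. s1 (f1 v) x) (\<lambda>v. s2 (f2 v) y) (\<lambda>v. s3 (f3 v) z)"
      using f1(1) f2(1) f3(1)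
      by (intro ops V1.burnside V2.burnside V3.burnside)
        (simp_all add: Vector_Spaces.linear_iff V1.scale_left_distrib V2.scale_left_distrib V3.scale_left_distrib)
    moreover have "\<phi> (\<lambda>v. s1 (f1 v) x) (\<lambda>v. s2 (f2 v) y) (\<lambda>v. s3 (f3 v) z) = l x y z * l' p1 p2 p3"
      using l unfolding p \<phi>_def tri_iff by (simp add: sum_distrib_left mult_ac)
    moreover have "\<psi> (\<lambda>v. s1 (f1 v) x) (\<lambda>v. s2 (f2 v) y) (\<lambda>v. s3 (f3 v) z) = l' x y z * K"
      using l' unfolding K_def \<psi>_def tri_iff by (simp add: sum_distrib_left mult_ac)
    ultimately show ?thesis by simp
  qed
  then have "l x y z = K / l' p1 p2 p3 * l' x y z" for x y z
    using ne by (simp add: field_simps)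
  then show ?thesis by blast
qed

end

section \<open>The tensor product and its invariant forms\<close>

lemma lookup_free_scale: "Poly_Mapping.lookup (free_scale c p) x = c * Poly_Mapping.lookup p x"
  by (simp add: free_scale_def Poly_Mapping.map.rep_eq when_def)

lemma vector_space_free_scale: "vector_space (free_scale :: 'f::field \<Rightarrow> ('x \<Rightarrow>\<^sub>0 'f) \<Rightarrow> _)"
  by unfold_locales (auto intro!: poly_mapping_eqI simp: lookup_free_scale lookup_add algebra_simps)

lemma free_scale_single: "free_scale c (Poly_Mapping.single x a) = Poly_Mapping.single x (c * a)"
  by (rule poly_mapping_eqI) (simp add: lookup_free_scale lookup_single when_def)

text \<open>Sums over a common finite superset of the supports allow terms to be compared although
  cancellation may shrink the support.\<close>

lemma free_map_eq_sum:
  assumes "finite A" "Poly_Mapping.keys p \<subseteq> A"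
  shows "free_map f p = (\<Sum>x\<in>A. Poly_Mapping.single (f x) (Poly_Mapping.lookup p x))"
  unfolding free_map_def using assms
  by (intro sum.mono_neutral_left) (auto simp: in_keys_iff)

lemma free_map_add: "free_map f (p + q) = free_map f p + free_map f q"
proof -
  let ?A = "Poly_Mapping.keys p \<union> Poly_Mapping.keys q"
  have "Poly_Mapping.keys (p + q) \<subseteq> ?A"
    by (rule Poly_Mapping.keys_add)
  then show ?thesis
    by (simp add: free_map_eq_sum[of ?A] lookup_add single_add sum.distrib)
qed

lemma free_map_scale:
  fixes f :: "'x \<Rightarrow> 'y" and p :: "'x \<Rightarrow>\<^sub>0 'f::field"
  shows "free_map f (free_scale c p) = free_scale c (free_map f p)"
proof -
  interpret vector_space "free_scale :: 'f \<Rightarrow> ('y \<Rightarrow>\<^sub>0 'f) \<Rightarrow> _"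
    by (rule vector_space_free_scale)
  have "Poly_Mapping.keys (free_scale c p) \<subseteq> Poly_Mapping.keys p"
    by (auto simp: in_keys_iff lookup_free_scale)
  then show ?thesis
    by (simp add: free_map_eq_sum[of "Poly_Mapping.keys p"] lookup_free_scale scale_sum_right free_scale_single)
qed

lemma free_map_diff: "free_map f (p - q) = free_map f p - free_map f q"
  using free_map_add[of f "p - q" q] by simp

lemma free_map_single: "free_map f (Poly_Mapping.single x a) = Poly_Mapping.single (f x) a"
  by (subst free_map_eq_sum[of "{x}"]) auto

section \<open>Forms on the quotient as trilinear maps\<close>

locale tensor3_spaces = tensor3 s1 s2 s3 + V1: vector_space s1 + V2: vector_space s2 + V3: vector_space s3
  for s1 :: "'f::field \<Rightarrow> 'u::ab_group_add \<Rightarrow> 'u"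
    and s2 :: "'f \<Rightarrow> 'v::ab_group_add \<Rightarrow> 'v"
    and s3 :: "'f \<Rightarrow> 'w::ab_group_add \<Rightarrow> 'w"
begin

sublocale free: vector_space "free_scale :: 'f \<Rightarrow> ('u \<times> 'v \<times> 'w \<Rightarrow>\<^sub>0 'f) \<Rightarrow> _"
  by (rule vector_space_free_scale)

lemma relators_intros:
  "gen (x + x') y z - gen x y z - gen x' y z \<in> relators"
  "gen x (y + y') z - gen x y z - gen x y' z \<in> relators"
  "gen x y (z + z') - gen x y z - gen x y z' \<in> relators"
  "gen (s1 c x) y z - free_scale c (gen x y z) \<in> relators"
  "gen x (s2 c y) z - free_scale c (gen x y z) \<in> relators"
  "gen x y (s3 c z) - free_scale c (gen x y z) \<in> relators"
proof -
  show "gen (x + x') y z - gen x y z - gen x' y z \<in> relators"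
    unfolding relators_def by (rule UnI1, rule UnI1, rule UnI1, rule UnI1, rule UnI1, rule CollectI,
      rule exI[of _ x], rule exI[of _ x'], rule exI[of _ y], rule exI[of _ z], simp)
  show "gen x (y + y') z - gen x y z - gen x y' z \<in> relators"
    unfolding relators_def by (rule UnI1, rule UnI1, rule UnI1, rule UnI1, rule UnI2, rule CollectI,
      rule exI[of _ x], rule exI[of _ y], rule exI[of _ y'], rule exI[of _ z], simp)
  show "gen x y (z + z') - gen x y z - gen x y z' \<in> relators"
    unfolding relators_def by (rule UnI1, rule UnI1, rule UnI1, rule UnI2, rule CollectI,
      rule exI[of _ x], rule exI[of _ y], rule exI[of _ z], rule exI[of _ z'], simp)
  show "gen (s1 c x) y z - free_scale c (gen x y z) \<in> relators"
    unfolding relators_def by (rule UnI1, rule UnI1, rule UnI2, rule CollectI,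
      rule exI[of _ c], rule exI[of _ x], rule exI[of _ y], rule exI[of _ z], simp)
  show "gen x (s2 c y) z - free_scale c (gen x y z) \<in> relators"
    unfolding relators_def by (rule UnI1, rule UnI2, rule CollectI,
      rule exI[of _ c], rule exI[of _ x], rule exI[of _ y], rule exI[of _ z], simp)
  show "gen x y (s3 c z) - free_scale c (gen x y z) \<in> relators"
    unfolding relators_def by (rule UnI2, rule CollectI,
      rule exI[of _ c], rule exI[of _ x], rule exI[of _ y], rule exI[of _ z], simp)
qed

abbreviation cl :: "('u \<times> 'v \<times> 'w \<Rightarrow>\<^sub>0 'f) \<Rightarrow> ('u \<times> 'v \<times> 'w \<Rightarrow>\<^sub>0 'f) set" where
  "cl p \<equiv> tensor_rel `` {p}"

lemma in_cl_iff: "(p, q) \<in> tensor_rel \<longleftrightarrow> p - q \<in> free.span relators"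
  by (simp add: tensor_rel_def)

lemma cl_refl: "p \<in> cl p"
  by (simp add: in_cl_iff free.span_zero)

lemma cl_eq_iff: "cl p = cl q \<longleftrightarrow> p - q \<in> free.span relators"
proof
  assume "cl p = cl q"
  then have "q \<in> cl p"
    using cl_refl[of q] by simp
  then show "p - q \<in> free.span relators"
    by (simp add: in_cl_iff)
next
  assume pq: "p - q \<in> free.span relators"
  have "p - r \<in> free.span relators \<longleftrightarrow> q - r \<in> free.span relators" for r
    using free.span_add[OF pq, of "q - r"] free.span_diff[of "p - r" relators "p - q", OF _ pq] by auto
  then show "cl p = cl q"
    by (auto simp: in_cl_iff)
qed

lemma cl_in_tensor: "cl p \<in> tensor"
  by (simp add: tensor_def quotientI)

lemma tensor_cases:
  assumes "A \<in> tensor"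
  obtains p where "A = cl p"
  using assms unfolding tensor_def by (rule quotientE)

lemma tensor_add_cl: "tensor_add (cl p) (cl q) = cl (p + q)"
proof -
  have "cl (p + q) = cl (p' + q')" if "p' \<in> cl p" "q' \<in> cl q" for p' q'
  proof -
    have "(p - p') + (q - q') \<in> free.span relators"
      using that by (intro free.span_add) (simp_all add: in_cl_iff)
    then have "(p + q) - (p' + q') \<in> free.span relators"
      by (simp add: algebra_simps)
    then show ?thesis
      by (simp only: cl_eq_iff[of "p + q"])
  qed
  then show ?thesis
    unfolding tensor_add_def by (intro UN_constant_eq[OF cl_refl] ballI) (rule sym)
qed

lemma tensor_scale_cl: "tensor_scale c (cl p) = cl (free_scale c p)"
proof -
  have "cl (free_scale c p) = cl (free_scale c p')" if "p' \<in> cl p" for p'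
  proof -
    have "free_scale c (p - p') \<in> free.span relators"
      using that by (intro free.span_scale) (simp add: in_cl_iff)
    then show ?thesis
      by (simp only: cl_eq_iff[of "free_scale c p"] free.scale_right_diff_distrib)
  qed
  then show ?thesis
    unfolding tensor_scale_def by (intro UN_constant_eq[OF cl_refl] ballI) (rule sym)
qed

text \<open>Linear maps send each multilinearity relator to a relator of the same kind, so the map
  on the free space preserves their span and descends.\<close>

lemma tensor_map_cl:
  assumes f: "Vector_Spaces.linear s1 s1 f" and g: "Vector_Spaces.linear s2 s2 g"
    and h: "Vector_Spaces.linear s3 s3 h"
  shows "tensor_map f g h (cl p) = cl (free_map (\<lambda>(x, y, z). (f x, g y, h z)) p)"
proof -
  let ?m = "free_map (\<lambda>(x, y, z). (f x, g y, h z)) :: ('u \<times> 'v \<times> 'w \<Rightarrow>\<^sub>0 'f) \<Rightarrow> _"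
  have lin: "f (x + x') = f x + f x'" "f (s1 c x) = s1 c (f x)" "g (y + y') = g y + g y'"
    "g (s2 c y) = s2 c (g y)" "h (z + z') = h z + h z'" "h (s3 c z) = s3 c (h z)" for x x' y y' z z' c
    using f g h by (simp_all add: Vector_Spaces.linear_iff)
  have rel: "?m r \<in> relators" if "r \<in> relators" for r
    using that[unfolded relators_def]
    by (elim UnE CollectE exE conjE)
      (simp_all only: free_map_diff free_map_scale free_map_single case_prod_conv lin relators_intros)
  have span: "?m r \<in> free.span relators" if "r \<in> free.span relators" for r
    using that
  proof (induction rule: free.span_induct_alt)
    case base
    then show ?case by (simp add: free_map_def free.span_zero)
  next
    case (step c x y)
    then show ?case
      unfolding free_map_add free_map_scale
      by (intro free.span_add free.span_scale) (auto intro: free.span_base rel)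
  qed
  have "cl (?m p) = cl (?m p')" if "p' \<in> cl p" for p'
  proof -
    have "?m p - ?m p' \<in> free.span relators"
      using span[of "p - p'"] that by (simp add: in_cl_iff free_map_diff)
    then show ?thesis
      by (simp only: cl_eq_iff[of "?m p"])
  qed
  then show ?thesis
    unfolding tensor_map_def by (intro UN_constant_eq[OF cl_refl] ballI) (rule sym)
qed

text \<open>Uniqueness in the universal property: classes of generators span the tensor
  product.\<close>

lemma form_determined:
  assumes "L \<in> invariant_forms \<rho>1 \<rho>2 \<rho>3"
  shows "L (cl p) = (\<Sum>(x, y, z)\<in>Poly_Mapping.keys p. Poly_Mapping.lookup p (x, y, z) * L (cl (gen x y z)))"
proof -
  have add: "L (cl (p + q)) = L (cl p) + L (cl q)" and scale: "L (cl (free_scale c p)) = c * L (cl p)" for p q c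
    using assms cl_in_tensor unfolding invariant_forms_def
    by (auto simp flip: tensor_add_cl tensor_scale_cl)
  have "L (cl 0) = 0"
    using scale[of 0 0] by simp
  then have sum: "L (cl (\<Sum>x\<in>A. F x)) = (\<Sum>x\<in>A. L (cl (F x)))" for A and F :: "'u \<times> 'v \<times> 'w \<Rightarrow> _"
    by (induction A rule: infinite_finite_induct) (auto simp: add)
  have "p = (\<Sum>x\<in>Poly_Mapping.keys p. Poly_Mapping.single x (Poly_Mapping.lookup p x))"
    by (rule poly_mapping_eqI) (auto simp: lookup_sum lookup_single when_def in_keys_iff)
  then have "L (cl p) = L (cl (\<Sum>x\<in>Poly_Mapping.keys p. free_scale (Poly_Mapping.lookup p x) (Poly_Mapping.single x 1)))"
    by (simp add: free_scale_single)
  also have "\<dots> = (\<Sum>x\<in>Poly_Mapping.keys p. Poly_Mapping.lookup p x * L (cl (Poly_Mapping.single x 1)))"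
    by (simp add: sum scale)
  finally show ?thesis
    by (simp add: case_prod_unfold)
qed

text \<open>The relators vanish in the quotient, so a form restricted to pure tensors is
  trilinear.\<close>

lemma invariant_form_gen:
  assumes L: "L \<in> invariant_forms \<rho>1 \<rho>2 \<rho>3"
  shows "L (cl (gen (x + x') y z)) = L (cl (gen x y z)) + L (cl (gen x' y z))"
    and "L (cl (gen x (y + y') z)) = L (cl (gen x y z)) + L (cl (gen x y' z))"
    and "L (cl (gen x y (z + z'))) = L (cl (gen x y z)) + L (cl (gen x y z'))"
    and "L (cl (gen (s1 c x) y z)) = c * L (cl (gen x y z))"
    and "L (cl (gen x (s2 c y) z)) = c * L (cl (gen x y z))"
    and "L (cl (gen x y (s3 c z))) = c * L (cl (gen x y z))"
proof -
  have add: "L (cl p) + L (cl q) = L (cl (p + q))" and scale: "c * L (cl p) = L (cl (free_scale c p))" for p q c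
    using L cl_in_tensor unfolding invariant_forms_def
    by (auto simp flip: tensor_add_cl tensor_scale_cl)
  have rel: "cl p = cl q" if "p - q \<in> relators" for p q
    using that cl_eq_iff free.span_base by blast
  show "L (cl (gen (x + x') y z)) = L (cl (gen x y z)) + L (cl (gen x' y z))"
    unfolding add by (intro arg_cong[of _ _ L] rel) (simp only: relators_intros flip: diff_diff_add)
  show "L (cl (gen x (y + y') z)) = L (cl (gen x y z)) + L (cl (gen x y' z))"
    unfolding add by (intro arg_cong[of _ _ L] rel) (simp only: relators_intros flip: diff_diff_add)
  show "L (cl (gen x y (z + z'))) = L (cl (gen x y z)) + L (cl (gen x y z'))"
    unfolding add by (intro arg_cong[of _ _ L] rel) (simp only: relators_intros flip: diff_diff_add)
  show "L (cl (gen (s1 c x) y z)) = c * L (cl (gen x y z))"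
    unfolding scale by (intro arg_cong[of _ _ L] rel) (rule relators_intros)
  show "L (cl (gen x (s2 c y) z)) = c * L (cl (gen x y z))"
    unfolding scale by (intro arg_cong[of _ _ L] rel) (rule relators_intros)
  show "L (cl (gen x y (s3 c z))) = c * L (cl (gen x y z))"
    unfolding scale by (intro arg_cong[of _ _ L] rel) (rule relators_intros)
qed

end

section \<open>Multiplicity one on the tensor product\<close>

lemma vector_space_form_scale: "vector_space (form_scale :: 'f::field \<Rightarrow> ('x \<Rightarrow> 'f) \<Rightarrow> _)"
  by unfold_locales (auto simp: form_scale_def fun_eq_iff algebra_simps)

context three_fd_reps_involution
begin

sublocale tensor3_spaces s1 s2 s3
  by (intro tensor3_spaces.intro V1.vector_space_axioms V2.vector_space_axioms V3.vector_space_axioms)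

lemma forms_proportional:
  assumes L: "L \<in> invariant_forms \<rho>1 \<rho>2 \<rho>3" and L': "L' \<in> invariant_forms \<rho>1 \<rho>2 \<rho>3" and ne: "L' \<noteq> 0"
  shows "\<exists>c. L = form_scale c L'"
proof -
  have tri: "tri (\<lambda>x y z. M (cl (gen x y z)))" if "M \<in> invariant_forms \<rho>1 \<rho>2 \<rho>3" for M
    unfolding tri_iff using invariant_form_gen[OF that] by simp
  have inv: "M (cl (gen (\<rho>1 g x) (\<rho>2 g y) (\<rho>3 g z))) = M (cl (gen x y z))"
    if "M \<in> invariant_forms \<rho>1 \<rho>2 \<rho>3" "g \<noteq> 0" for M g x y z
  proof -
    have "M (tensor_map (\<rho>1 g) (\<rho>2 g) (\<rho>3 g) (cl (gen x y z))) = M (cl (gen x y z))"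
      using that cl_in_tensor unfolding invariant_forms_def by blast
    then show ?thesis
      using that(2) by (simp add: tensor_map_cl V1.rep_linear V2.rep_linear V3.rep_linear free_map_single)
  qed
  have outside: "M A = 0" if "M \<in> invariant_forms \<rho>1 \<rho>2 \<rho>3" "A \<notin> tensor" for M A
    using that unfolding invariant_forms_def by blast
  have "\<exists>x y z. L' (cl (gen x y z)) \<noteq> 0"
  proof (rule ccontr)
    assume "\<not> ?thesis"
    then have "L' (cl p) = 0" for p
      by (subst form_determined[OF L']) (simp add: case_prod_unfold)
    then have "L' A = 0" for A
      using outside[OF L'] by (cases "A \<in> tensor") (auto elim: tensor_cases)
    with ne show False by (simp add: fun_eq_iff)
  qed
  then obtain x0 y0 z0 where ne: "L' (cl (gen x0 y0 z0)) \<noteq> 0" by blast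
  have "\<exists>c. \<forall>x y z. L (cl (gen x y z)) = c * L' (cl (gen x y z))"
    by (rule invariant_forms_proportional[OF tri[OF L] tri[OF L'] _ _ ne]) (simp_all add: inv[OF L] inv[OF L'])
  then obtain c where c: "\<And>x y z. L (cl (gen x y z)) = c * L' (cl (gen x y z))"
    by blast
  have "L (cl p) = c * L' (cl p)" for p
    by (subst form_determined[OF L], subst form_determined[OF L'])
      (simp add: c sum_distrib_left case_prod_unfold mult_ac)
  then have "L A = c * L' A" for A
    using outside[OF L] outside[OF L'] by (cases "A \<in> tensor") (auto elim: tensor_cases)
  then show ?thesis
    by (auto simp: form_scale_def fun_eq_iff)
qed

text \<open>The finite spanning set accompanies the bound because \<open>dim\<close> is 0 by
  convention for infinite-dimensional spaces; one nonzero form, if there is any, spans.\<close>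

lemma invariant_forms_dim_le_1:
  "(\<exists>B. finite B \<and> invariant_forms \<rho>1 \<rho>2 \<rho>3 \<subseteq> Modules.module.span form_scale B) \<and>
    vector_space.dim form_scale (invariant_forms \<rho>1 \<rho>2 \<rho>3) \<le> 1"
proof -
  interpret forms: vector_space "form_scale :: 'f \<Rightarrow> (('u \<times> 'v \<times> 'w \<Rightarrow>\<^sub>0 'f) set \<Rightarrow> 'f) \<Rightarrow> _"
    by (rule vector_space_form_scale)
  have "\<exists>L0. invariant_forms \<rho>1 \<rho>2 \<rho>3 \<subseteq> forms.span {L0}"
  proof (cases "invariant_forms \<rho>1 \<rho>2 \<rho>3 \<subseteq> {0}")
    case True
    then show ?thesis by (auto intro: forms.span_zero)
  next
    case False
    then obtain L0 where "L0 \<in> invariant_forms \<rho>1 \<rho>2 \<rho>3" "L0 \<noteq> 0" by blast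
    then show ?thesis
      using forms_proportional[of _ L0] by (intro exI[of _ L0]) (auto simp: forms.span_singleton image_iff)
  qed
  then obtain L0 where L0: "invariant_forms \<rho>1 \<rho>2 \<rho>3 \<subseteq> forms.span {L0}" by blast
  then show ?thesis
    using forms.dim_le_card[OF L0] by (intro conjI exI[of _ "{L0}"]) auto
qed

end

section \<open>The canonical involution of a quaternion division algebra\<close>

context quaternion_division_algebra
begin

abbreviation scalars :: "'d set" where
  "scalars \<equiv> range (\<lambda>c. scaleD c 1)"

lemma scalars_iff_central: "x \<in> scalars \<longleftrightarrow> (\<forall>y. x * y = y * x)"
  using central by auto

lemma in_span_pair: "y \<in> span {u, v} \<longleftrightarrow> (\<exists>a b. y = scaleD a u + scaleD b v)"
proof -
  have "y \<in> span {u, v} \<longleftrightarrow> (\<exists>a b. y - scaleD a u - scaleD b v = 0)"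
    by (simp add: span_breakdown_eq)
  also have "\<dots> \<longleftrightarrow> (\<exists>a b. y = scaleD a u + scaleD b v)"
    by (simp add: algebra_simps)
  finally show ?thesis .
qed

lemma in_span_triple: "y \<in> span {u, v, w} \<longleftrightarrow> (\<exists>a b c. y = scaleD a u + scaleD b v + scaleD c w)"
proof -
  have "y \<in> span {u, v, w} \<longleftrightarrow> (\<exists>a b c. y - scaleD a u - scaleD b v - scaleD c w = 0)"
    by (simp add: span_breakdown_eq)
  also have "\<dots> \<longleftrightarrow> (\<exists>a b c. y = scaleD a u + scaleD b v + scaleD c w)"
    by (simp add: algebra_simps)
  finally show ?thesis .
qed

lemma finite_basis:
  obtains B where "finite B" "independent B" "span B = UNIV" "card B = 4"
proof -
  obtain B where B: "independent B" "span B = span UNIV" "card B = dim UNIV"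
    using basis_exists[of UNIV] by (metis span_UNIV subset_antisym top_greatest)
  then have "finite B" "card B = 4"
    using dim_4 by (auto intro: card_ge_0_finite)
  with B that show thesis by auto
qed

lemma four_independent_span:
  assumes "a \<noteq> 0" "b \<notin> span {a}" "c \<notin> span {a, b}" "d \<notin> span {a, b, c}"
  shows "span {a, b, c, d} = UNIV"
proof -
  obtain B where B: "finite B" "independent B" "span B = UNIV" "card B = 4"
    by (rule finite_basis)
  interpret finite_dimensional_vector_space scaleD B
    using B by unfold_locales auto
  have "b \<noteq> a" "c \<notin> {a, b}" "d \<notin> {a, b, c}"
    using assms span_base[of a "{a}"] span_base[of _ "{a, b}"] span_base[of _ "{a, b, c}"] by auto
  then have 1: "card {d, c, b, a} = 4" by auto
  have eqs: "{c, b, a} = {a, b, c}" "{b, a} = {a, b}"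
    by auto
  have "independent {d, c, b, a}"
    using assms eqs by (intro independent_insertI) (simp_all add: local.independent_empty)
  then have "UNIV \<subseteq> span {d, c, b, a}"
    using 1 dim_4 by (intro card_ge_dim_independent) auto
  then show ?thesis
    by (auto simp: insert_commute)
qed

lemma commute_span:
  assumes "\<And>s. s \<in> S \<Longrightarrow> x * s = s * x" "y \<in> span S"
  shows "x * y = y * x"
  using assms(2)
  by (induction rule: span_induct_alt)
    (auto simp: assms(1) distrib_left distrib_right scale_mult_left scale_mult_right)

text \<open>As a rewrite rule, \<open>mult_2\<close> would loop with the simplification procedure that collects
  numerals.\<close>

lemma scaleD_two:
  "scaleD (2 * a) x = scaleD a x + scaleD a x"
  "scaleD (a * 2) x = scaleD a x + scaleD a x"
  "scaleD (a * (b * 2)) x = scaleD (a * b) x + scaleD (a * b) x"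
  by (simp_all only: mult_2 mult_2_right scale_left_distrib distrib_left)

lemmas scaleD_simps = scaleD_two scale_mult_left scale_mult_right scale_right_distrib scale_left_distrib
  scale_right_diff_distrib scale_left_diff_distrib distrib_left distrib_right
  left_diff_distrib right_diff_distrib mult.assoc

text \<open>Degree 3 is impossible inside dimension 4. Otherwise \<open>1, x, x * x\<close> span a
  space \<open>K\<close> of dimension 3; it is closed under multiplication by \<open>x\<close>,
  since a fourth independent power would fill the algebra and make \<open>x\<close> central. The
  quotient by \<open>K\<close> is a line, on which \<open>x\<close> acts as a scalar
  \<open>c\<close>; but \<open>x - c\<close> is invertible with inverse in \<open>K\<close>, so the
  quotient would vanish.\<close>

lemma quadratic_ex: "\<exists>t n. x * x = scaleD t x - scaleD n 1"
proof (cases "x \<in> scalars")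
  case True
  then obtain c where "x = scaleD c 1" by (rule rangeE)
  then have "x * x = scaleD (2 * c) x - scaleD (c * c) 1"
    by (simp add: scaleD_simps)
  then show ?thesis by blast
next
  case False
  show ?thesis
  proof (rule ccontr)
    assume neg: "\<not> ?thesis"
    have x1: "x \<notin> span {1}"
      using False by (auto simp: span_singleton)
    have x2: "x * x \<notin> span {1, x}"
    proof
      assume "x * x \<in> span {1, x}"
      then obtain a b where "x * x = scaleD a 1 + scaleD b x"
        by (auto simp: in_span_pair)
      then have "x * x = scaleD b x - scaleD (- a) 1"
        by (simp add: algebra_simps)
      with neg show False by blast
    qed
    let ?K = "span {1, x, x * x}"
    have base: "1 \<in> ?K" "x \<in> ?K" "x * x \<in> ?K"
      by (auto intro: span_base)
    obtain z where z: "x * z \<noteq> z * x"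
      using False scalars_iff_central by blast
    have x3: "x * x * x \<in> ?K"
    proof (rule ccontr)
      assume "\<not> ?thesis"
      then have "span {1, x, x * x, x * x * x} = UNIV"
        using x1 x2 by (intro four_independent_span) auto
      then have "x * z = z * x"
        by - (rule commute_span[of "{1, x, x * x, x * x * x}"], auto simp: mult.assoc)
      with z show False ..
    qed
    have Kx: "x * k \<in> ?K" if "k \<in> ?K" for k
    proof -
      from that obtain a b c where "k = scaleD a 1 + scaleD b x + scaleD c (x * x)"
        by (auto simp: in_span_triple)
      then have "x * k = scaleD a x + scaleD b (x * x) + scaleD c (x * x * x)"
        by (simp add: scaleD_simps)
      then show ?thesis
        using base x3 by (auto intro!: span_add span_scale)
    qed
    obtain y where y: "y \<notin> ?K"
    proof -
      have "\<exists>y. y \<notin> ?K"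
      proof (rule ccontr)
        assume "\<not> ?thesis"
        then have "x * z = z * x"
          by - (rule commute_span[of "{1, x, x * x}"], auto simp: mult.assoc)
        with z show False ..
      qed
      then show ?thesis using that by blast
    qed
    \<comment> \<open>\<open>y\<close> completes \<open>K\<close> to the whole algebra, and
      \<open>c\<close> is the scalar by which \<open>x\<close> acts modulo \<open>K\<close>.\<close>
    have "x * y \<in> span (insert y {1, x, x * x})"
      using four_independent_span[OF one_neq_zero x1 x2 y] by (simp add: insert_commute)
    then obtain c where c: "x * y - scaleD c y \<in> ?K"
      by (auto simp: span_breakdown_eq[of "x * y" y])
    obtain g b a where abg: "x * x * x = scaleD g 1 + scaleD b x + scaleD a (x * x)"
      using x3 by (auto simp: in_span_triple)
    txt \<open>Dividing \<open>X\<^sup>3 - a X\<^sup>2 - b X - g\<close> by \<open>X - c\<close> leaves the quotient \<open>q\<close> and the remainder \<open>r\<close>.\<close>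
    define q where "q = x * x + scaleD (c - a) x + scaleD (c * c - a * c - b) 1"
    define r where "r = c * c * c - a * (c * c) - b * c - g"
    have qxc: "q * (x - scaleD c 1) = - scaleD r 1"
      unfolding q_def r_def using abg by (simp add: scaleD_simps algebra_simps)
    have "x - scaleD c 1 \<noteq> 0"
      using False by auto
    moreover have "q \<noteq> 0"
    proof
      assume "q = 0"
      then have "x * x = scaleD (- (c * c - a * c - b)) 1 + scaleD (- (c - a)) x"
        unfolding q_def by (simp add: algebra_simps eq_neg_iff_add_eq_0)
      then show False using x2 in_span_pair by blast
    qed
    ultimately have "scaleD r 1 \<noteq> 0"
      using qxc by (metis mult_eq_0_iff neg_equal_0_iff_equal)
    then have "r \<noteq> 0" by auto
    have qK: "q * k \<in> ?K" if "k \<in> ?K" for k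
    proof -
      have "q * k = x * (x * k) + scaleD (c - a) (x * k) + scaleD (c * c - a * c - b) k"
        by (simp add: q_def scaleD_simps)
      then show ?thesis
        using that by (auto intro!: span_add span_scale Kx)
    qed
    have "q * (x * y - scaleD c y) = scaleD (- r) y"
    proof -
      have "q * (x * y - scaleD c y) = q * (x - scaleD c 1) * y"
        by (simp add: scaleD_simps)
      then show ?thesis
        unfolding qxc by (simp add: scale_mult_left)
    qed
    then have "scaleD (- r) y \<in> ?K"
      using qK[OF c] by simp
    then have "scaleD (inverse (- r)) (scaleD (- r) y) \<in> ?K"
      by (rule span_scale)
    also have "scaleD (inverse (- r)) (scaleD (- r) y) = y"
      using \<open>r \<noteq> 0\<close> by simp
    finally have "y \<in> ?K" .
    with y show False ..
  qed
qed

text \<open>The reduced trace. The quadratic relation determines \<open>t\<close> only off the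
  scalars; for a scalar every \<open>t\<close> fits, and the second conjunct fixes the value
  \<open>2 * c\<close>.\<close>

definition rtrace :: "'d \<Rightarrow> 'k" where
  "rtrace x = (THE t. (\<exists>n. x * x = scaleD t x - scaleD n 1) \<and> (\<forall>c. x = scaleD c 1 \<longrightarrow> t = 2 * c))"

lemma rtrace_scalar: "rtrace (scaleD c 1) = 2 * c"
  unfolding rtrace_def
proof (rule the_equality)
  show "(\<exists>n. scaleD c 1 * scaleD c 1 = scaleD (2 * c) (scaleD c 1) - scaleD n 1) \<and>
    (\<forall>d. scaleD c 1 = scaleD d 1 \<longrightarrow> 2 * c = 2 * d)"
    by (intro conjI exI[of _ "c * c"]) (auto simp: scaleD_simps)
qed auto

lemma rtrace_eqI:
  assumes "x \<notin> scalars" "x * x = scaleD t x - scaleD n 1"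
  shows "rtrace x = t"
  unfolding rtrace_def
proof (rule the_equality)
  show "(\<exists>n. x * x = scaleD t x - scaleD n 1) \<and> (\<forall>c. x = scaleD c 1 \<longrightarrow> t = 2 * c)"
    using assms by auto
next
  fix t' assume "(\<exists>n. x * x = scaleD t' x - scaleD n 1) \<and> (\<forall>c. x = scaleD c 1 \<longrightarrow> t' = 2 * c)"
  then obtain n' where "x * x = scaleD t' x - scaleD n' 1" by blast
  with assms have *: "scaleD (t' - t) x = scaleD (n' - n) 1"
    by (simp add: algebra_simps)
  show "t' = t"
  proof (rule ccontr)
    assume "t' \<noteq> t"
    then have "x = scaleD (inverse (t' - t)) (scaleD (t' - t) x)"
      by simp
    also have "\<dots> = scaleD (inverse (t' - t) * (n' - n)) 1"
      unfolding * by simp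
    finally show False using assms by blast
  qed
qed

lemma rtrace_quadratic: "\<exists>n. x * x = scaleD (rtrace x) x - scaleD n 1"
proof (cases "x \<in> scalars")
  case True
  then obtain c where "x = scaleD c 1" by (rule rangeE)
  then have "x * x = scaleD (rtrace x) x - scaleD (c * c) 1"
    by (simp add: rtrace_scalar scaleD_simps)
  then show ?thesis by blast
next
  case False
  then show ?thesis
    using quadratic_ex[of x] rtrace_eqI by metis
qed

lemma rtrace_affine: "rtrace (scaleD a 1 + scaleD b x) = 2 * a + b * rtrace x"
proof (cases "x \<in> scalars \<or> b = 0")
  case True
  show ?thesis
  proof (cases "b = 0")
    case False
    with True obtain c where "x = scaleD c 1" by auto
    then have "scaleD a 1 + scaleD b x = scaleD (a + b * c) 1"
      by (simp add: scaleD_simps)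
    then show ?thesis
      using \<open>x = scaleD c 1\<close> by (simp only: rtrace_scalar) (simp add: algebra_simps)
  qed (simp add: rtrace_scalar)
next
  case False
  obtain n where n: "x * x = scaleD (rtrace x) x - scaleD n 1"
    using rtrace_quadratic by blast
  show ?thesis
  proof (rule rtrace_eqI)
    show "scaleD a 1 + scaleD b x \<notin> scalars"
    proof
      assume "scaleD a 1 + scaleD b x \<in> scalars"
      then obtain c where "scaleD a 1 + scaleD b x = scaleD c 1" by blast
      then have *: "scaleD b x = scaleD (c - a) 1"
        by (simp add: algebra_simps)
      have "x = scaleD (inverse b) (scaleD b x)"
        using False by simp
      also have "\<dots> = scaleD (inverse b * (c - a)) 1"
        unfolding * by simp
      finally show False using False by blast
    qed
    \<comment> \<open>The last coefficient is the norm of \<open>a + b x\<close>, obtained from norm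
      \<open>n\<close> and trace of \<open>x\<close>.\<close>
    show "(scaleD a 1 + scaleD b x) * (scaleD a 1 + scaleD b x) =
      scaleD (2 * a + b * rtrace x) (scaleD a 1 + scaleD b x)
      - scaleD (a * a + a * b * rtrace x + b * b * n) 1"
      by (simp add: scaleD_simps n algebra_simps)
  qed
qed

lemma rtrace_scale: "rtrace (scaleD b x) = b * rtrace x"
  using rtrace_affine[of 0 b x] by simp

end

locale quaternion_division_algebra_big = quaternion_division_algebra scaleD
  for scaleD :: "'k::field \<Rightarrow> 'd::division_ring \<Rightarrow> 'd" +
  assumes more_than_two_scalars: "\<exists>c :: 'k. c \<noteq> 0 \<and> c \<noteq> 1"
begin

text \<open>Squaring \<open>x + y\<close> and \<open>x + c y\<close> expresses
  \<open>x * y + y * x\<close> in two ways through \<open>x\<close>, \<open>y\<close>, 1. When these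
  are independent, comparing coefficients gives two linear equations whose difference is
  \<open>(c - 1) * (T - (t + s)) = 0\<close>; this is where a scalar other than 0 and 1
  enters.\<close>

lemma rtrace_add: "rtrace (x + y) = rtrace x + rtrace y"
proof (cases "x \<in> scalars")
  case True
  then obtain c where "x = scaleD c 1" by (rule rangeE)
  then show ?thesis
    using rtrace_affine[of c 1 y] by (simp add: rtrace_scalar)
next
  case x: False
  show ?thesis
  proof (cases "y \<in> span {1, x}")
    case True
    then obtain a b where y: "y = scaleD a 1 + scaleD b x"
      by (auto simp: in_span_pair)
    then have "x + y = scaleD a 1 + scaleD (1 + b) x"
      by (simp add: scaleD_simps)
    then show ?thesis
      unfolding y by (simp only: rtrace_affine) (simp add: algebra_simps)
  next
    case False
    have coeffs: "\<alpha> = 0 \<and> \<beta> = 0" if "scaleD \<alpha> x + scaleD \<beta> y = scaleD \<gamma> 1" for \<alpha> \<beta> \<gamma>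
    proof -
      have "\<beta> = 0"
      proof (rule ccontr)
        assume "\<beta> \<noteq> 0"
        then have "y = scaleD (inverse \<beta>) (scaleD \<beta> y)" by simp
        also have "scaleD \<beta> y = scaleD \<gamma> 1 - scaleD \<alpha> x"
          using that by (simp add: algebra_simps)
        also have "scaleD (inverse \<beta>) \<dots> = scaleD (inverse \<beta> * \<gamma>) 1 + scaleD (- inverse \<beta> * \<alpha>) x"
          by (simp add: scaleD_simps)
        finally show False using False in_span_pair by blast
      qed
      moreover have "\<alpha> = 0"
      proof (rule ccontr)
        assume "\<alpha> \<noteq> 0"
        then have "x = scaleD (inverse \<alpha>) (scaleD \<alpha> x)" by simp
        also have "\<dots> = scaleD (inverse \<alpha> * \<gamma>) 1"
          using that \<open>\<beta> = 0\<close> by simp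
        finally show False using x by blast
      qed
      ultimately show ?thesis by simp
    qed
    obtain c :: 'k where c: "c \<noteq> 0" "c \<noteq> 1"
      using more_than_two_scalars by blast
    define t s where "t = rtrace x" and "s = rtrace y"
    obtain n where n: "x * x = scaleD t x - scaleD n 1"
      unfolding t_def using rtrace_quadratic by blast
    obtain m where m: "y * y = scaleD s y - scaleD m 1"
      unfolding s_def using rtrace_quadratic by blast
    define T U where "T = rtrace (x + y)" and "U = rtrace (x + scaleD c y)"
    obtain n1 where n1: "(x + y) * (x + y) = scaleD T (x + y) - scaleD n1 1"
      unfolding T_def using rtrace_quadratic by blast
    obtain n2 where n2: "(x + scaleD c y) * (x + scaleD c y) = scaleD U (x + scaleD c y) - scaleD n2 1"
      unfolding U_def using rtrace_quadratic by blast
    have "x * y + y * x = (x + y) * (x + y) - x * x - y * y"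
      by (simp add: distrib_left distrib_right)
    then have xy: "x * y + y * x = scaleD (T - t) x + scaleD (T - s) y + scaleD (n + m - n1) 1"
      unfolding n1 n m by (simp add: scaleD_simps)
    have "scaleD c (x * y + y * x) =
        (x + scaleD c y) * (x + scaleD c y) - x * x - scaleD (c * c) (y * y)"
      by (simp add: scaleD_simps)
    then have "scaleD c (x * y + y * x) =
        scaleD (U - t) x + scaleD (U * c - c * c * s) y + scaleD (n + c * c * m - n2) 1"
      unfolding n2 n m by (simp add: scaleD_simps)
    then have "scaleD (U - t - c * (T - t)) x + scaleD (U * c - c * c * s - c * (T - s)) y =
        scaleD (c * (n + m - n1) - (n + c * c * m - n2)) 1"
      unfolding xy by (simp add: scaleD_simps algebra_simps)
    from coeffs[OF this] have "U - t - c * (T - t) = 0" "c * (U - c * s - (T - s)) = 0"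
      by (auto simp: algebra_simps)
    then have U: "U - t - c * (T - t) = 0" "U - c * s - (T - s) = 0"
      using c by auto
    have "(c - 1) * (T - (t + s)) = (U - c * s - (T - s)) - (U - t - c * (T - t))"
      by (simp add: algebra_simps)
    also have "\<dots> = 0"
      by (simp only: U diff_self)
    finally show ?thesis
      using c by (simp add: T_def t_def s_def)
  qed
qed

section \<open>The canonical involution and the norm\<close>

definition qbar :: "'d \<Rightarrow> 'd" where
  "qbar x = scaleD (rtrace x) 1 - x"

lemma qbar_add: "qbar (x + y) = qbar x + qbar y"
  by (simp add: qbar_def rtrace_add scale_left_distrib)

lemma qbar_scaleD: "qbar (scaleD c x) = scaleD c (qbar x)"
  by (simp add: qbar_def rtrace_scale scale_right_diff_distrib)

lemma qbar_scalar: "qbar (scaleD c 1) = scaleD c 1"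
  by (simp add: qbar_def rtrace_scalar scaleD_two)

lemma qbar_qbar: "qbar (qbar x) = x"
  using rtrace_affine[of "rtrace x" "-1" x] by (simp add: qbar_def)

lemma qbar_0: "qbar 0 = 0"
  using qbar_scalar[of 0] by simp

lemma qbar_eq_0: "qbar x = 0 \<Longrightarrow> x = 0"
  using qbar_qbar[of x] qbar_0 by simp

lemma norm_ex: "\<exists>n. x * qbar x = scaleD n 1 \<and> qbar x * x = scaleD n 1"
proof -
  obtain n where "x * x = scaleD (rtrace x) x - scaleD n 1"
    using rtrace_quadratic by blast
  then show ?thesis
    by (intro exI[of _ n]) (simp add: qbar_def scaleD_simps)
qed

text \<open>Scalar sum and product give a quadratic relation with trace \<open>s\<close>, which is
  unique for a nonscalar element.\<close>

lemma qbar_eqI: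
  assumes "z \<notin> scalars" "z + w = scaleD s 1" "z * w = scaleD m 1"
  shows "qbar z = w"
proof -
  have w: "w = scaleD s 1 - z"
    using assms(2) by (simp add: algebra_simps)
  have "z * z = scaleD s z - z * w"
    by (simp add: w scaleD_simps)
  then have "z * z = scaleD s z - scaleD m 1"
    by (simp only: assms(3))
  then have "rtrace z = s"
    using assms(1) by (intro rtrace_eqI)
  then show ?thesis by (simp add: qbar_def w)
qed

text \<open>The shape with \<open>qbar y\<close> is chosen for polarization:
  \<open>x * qbar y + y * qbar x\<close> is the norm of \<open>x + y\<close> minus those of
  \<open>x\<close> and \<open>y\<close>, hence scalar, and the product of the two terms is the
  product of the norms. So the terms are conjugate to each other by \<open>qbar_eqI\<close>.\<close>

lemma qbar_mult_qbar: "qbar (x * qbar y) = y * qbar x"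
proof -
  obtain n where n: "x * qbar x = scaleD n 1" "qbar x * x = scaleD n 1"
    using norm_ex by blast
  obtain m where m: "y * qbar y = scaleD m 1" "qbar y * y = scaleD m 1"
    using norm_ex by blast
  obtain k where k: "(x + y) * qbar (x + y) = scaleD k 1"
    using norm_ex by blast
  show ?thesis
  proof (cases "x * qbar y \<in> scalars")
    case False
    show ?thesis
    proof (rule qbar_eqI[OF False])
      show "x * qbar y + y * qbar x = scaleD (k - n - m) 1"
        using n m k by (simp add: qbar_add scaleD_simps algebra_simps)
      have "x * qbar y * (y * qbar x) = x * (qbar y * y) * qbar x"
        by (simp add: mult.assoc)
      also have "\<dots> = scaleD (m * n) 1"
        by (simp add: m n scaleD_simps)
      finally show "x * qbar y * (y * qbar x) = scaleD (m * n) 1" .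
    qed
  next
    \<comment> \<open>Here the quadratic relation says nothing, but \<open>x\<close> and
      \<open>y\<close> are proportional: multiplying by \<open>y\<close> on the right gives
      \<open>m x = c y\<close>.\<close>
    case True
    then obtain c where c: "x * qbar y = scaleD c 1" by (rule rangeE)
    show ?thesis
    proof (cases "y = 0")
      case False
      then have "y * qbar y \<noteq> 0"
        using qbar_eq_0 by auto
      then have "m \<noteq> 0" using m by auto
      have "scaleD m x = x * qbar y * y"
        by (simp add: m mult.assoc scaleD_simps)
      then have "scaleD m x = scaleD c y"
        by (simp add: c scaleD_simps)
      then have "scaleD m (y * qbar x) = scaleD m (scaleD c 1)"
        using m by (simp add: mult.commute flip: qbar_scaleD scale_mult_right)
          (simp add: qbar_scaleD scale_mult_right)
      then have "y * qbar x = scaleD c 1"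
        by (rule scale_left_imp_eq[OF \<open>m \<noteq> 0\<close>])
      then show ?thesis by (simp add: c qbar_scalar)
    qed (simp add: qbar_0)
  qed
qed

lemma qbar_mult: "qbar (x * y) = qbar y * qbar x"
  using qbar_mult_qbar[of x "qbar y"] by (simp add: qbar_qbar)

text \<open>After replacing \<open>x * x\<close> by its quadratic relation, both sides are
  \<open>x y x - t y x + n y\<close>. Exchanging \<open>x\<close> and \<open>y\<close> only changes
  the sign of the commutator, so it intertwines \<open>y\<close> with its conjugate as well.\<close>

lemma commutator_intertwines: "(x * y - y * x) * x = qbar x * (x * y - y * x)"
proof -
  obtain n where n: "x * x = scaleD (rtrace x) x - scaleD n 1"
    using rtrace_quadratic by blast
  have "x * (x * y) = scaleD (rtrace x) (x * y) - scaleD n y"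
    using arg_cong[OF n, of "\<lambda>u. u * y"] by (simp add: scaleD_simps)
  then show ?thesis
    by (simp add: qbar_def scaleD_simps n)
qed

text \<open>A nonscalar \<open>x\<close> generates a maximal subfield. For a further commuting
  \<open>y\<close>, the product \<open>x * y\<close> lies in the span of \<open>1, x, y\<close>,
  since otherwise these four elements would make \<open>x\<close> central; solving that relation for
  \<open>y\<close> means dividing by \<open>x - c\<close>, whose inverse is a multiple of its
  conjugate and lies in the span of \<open>1, x\<close>.\<close>

lemma commuting_in_span:
  assumes "x \<notin> scalars" "x * y = y * x"
  shows "y \<in> span {1, x}"
proof (rule ccontr)
  assume y: "y \<notin> span {1, x}"
  have x1: "x \<notin> span {1}"
    using assms by (auto simp: span_singleton)
  obtain z where z: "x * z \<noteq> z * x"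
    using assms scalars_iff_central by blast
  have "x * y \<in> span {1, x, y}"
  proof (rule ccontr)
    assume "\<not> ?thesis"
    then have "span {1, x, y, x * y} = UNIV"
      using x1 y by (intro four_independent_span) auto
    then have "x * z = z * x"
      by - (rule commute_span[of "{1, x, y, x * y}"], auto simp: mult.assoc assms(2)[symmetric])
    with z show False ..
  qed
  then obtain a b c where abc: "x * y = scaleD a 1 + scaleD b x + scaleD c y"
    by (auto simp: in_span_triple)
  define u where "u = x - scaleD c 1"
  have "u \<noteq> 0"
    using assms by (auto simp: u_def)
  obtain n where n: "qbar u * u = scaleD n 1"
    using norm_ex by blast
  have "qbar u * u \<noteq> 0"
    using \<open>u \<noteq> 0\<close> qbar_eq_0 by auto
  then have "n \<noteq> 0" using n by auto
  have uy: "u * y = scaleD a 1 + scaleD b x"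
    using abc by (simp add: u_def scaleD_simps)
  obtain m where m: "x * x = scaleD (rtrace x) x - scaleD m 1"
    using rtrace_quadratic by blast
  have "scaleD n y = qbar u * u * y"
    by (simp add: n scaleD_simps)
  also have "\<dots> = qbar u * (scaleD a 1 + scaleD b x)"
    by (simp add: mult.assoc uy)
  also have "\<dots> \<in> span {1, x}"
    unfolding in_span_pair
    by (rule exI[of _ "(rtrace u + c) * a + b * m"], rule exI[of _ "(rtrace u + c) * b - a - b * rtrace x"])
      (simp add: qbar_def u_def scaleD_simps m algebra_simps)
  finally have "scaleD (inverse n) (scaleD n y) \<in> span {1, x}"
    by (rule span_scale)
  then show False
    using y \<open>n \<noteq> 0\<close> by simp
qed

text \<open>In the commuting case the commutator is zero; it is replaced by the commutator of the
  nonscalar element with some \<open>z\<close> outside its centralizer. The other element is affine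
  in the first and follows along.\<close>

lemma simultaneous_conjugation:
  "\<exists>d. d \<noteq> 0 \<and> d * x = qbar x * d \<and> d * y = qbar y * d"
proof -
  have comm: "\<exists>d. d \<noteq> 0 \<and> d * x = qbar x * d \<and> d * y = qbar y * d"
    if x: "x \<notin> scalars" "x * y = y * x" for x y
  proof -
    obtain z where z: "x * z \<noteq> z * x"
      using x scalars_iff_central by blast
    obtain a b where y: "y = scaleD a 1 + scaleD b x"
      using commuting_in_span[OF x] in_span_pair by blast
    define d where "d = x * z - z * x"
    have d: "d \<noteq> 0" "d * x = qbar x * d"
      using z commutator_intertwines by (simp_all add: d_def)
    have "d * y = qbar y * d"
      unfolding y by (simp add: qbar_add qbar_scalar) (simp add: qbar_scaleD scaleD_simps d)
    with d show ?thesis by blast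
  qed
  consider "x * y \<noteq> y * x" | "x * y = y * x" "x \<notin> scalars" | "x * y = y * x" "y \<notin> scalars"
    | "x \<in> scalars" "y \<in> scalars" by blast
  then show ?thesis
  proof cases
    case 1
    have "(x * y - y * x) * y = qbar y * (x * y - y * x)"
      using commutator_intertwines[of y x] by (simp add: algebra_simps)
    then show ?thesis
      using 1 commutator_intertwines[of x y] by (intro exI[of _ "x * y - y * x"]) auto
  next
    case 2
    then show ?thesis using comm by blast
  next
    case 3
    then show ?thesis using comm[of y x] by metis
  next
    case 4
    then show ?thesis
      by (intro exI[of _ 1]) (auto simp: qbar_scalar)
  qed
qed

text \<open>Left division by \<open>g3\<close> turns the triple into the pair
  \<open>inverse g3 * g1\<close>, \<open>inverse g3 * g2\<close> up to simultaneous conjugation. A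
  conjugating \<open>d\<close> for the pair yields \<open>x = d * inverse g3\<close> and
  \<open>y = inverse d * qbar g3\<close>.\<close>

lemma conjugating_involution_qbar: "conjugating_involution qbar"
proof
  show "qbar (x * y) = qbar y * qbar x" for x y by (rule qbar_mult)
  show "qbar (qbar x) = x" for x by (rule qbar_qbar)
  show "qbar 0 = 0" by (rule qbar_0)
  fix g1 g2 g3 :: 'd assume g: "g1 \<noteq> 0" "g2 \<noteq> 0" "g3 \<noteq> 0"
  obtain d where d: "d \<noteq> 0" "d * (inverse g3 * g1) = qbar (inverse g3 * g1) * d"
      "d * (inverse g3 * g2) = qbar (inverse g3 * g2) * d"
    using simultaneous_conjugation by blast
  define x y where "x = d * inverse g3" and "y = inverse d * qbar g3"
  have *: "x * g * y = qbar g" if "d * (inverse g3 * g) = qbar (inverse g3 * g) * d" for g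
  proof -
    have "x * g * y = d * (inverse g3 * g) * inverse d * qbar g3"
      by (simp add: x_def y_def mult.assoc)
    also have "\<dots> = qbar (inverse g3 * g) * qbar g3"
      using d(1) unfolding that by (simp add: mult.assoc)
    also have "\<dots> = qbar (g3 * (inverse g3 * g))"
      by (simp add: qbar_mult)
    also have "g3 * (inverse g3 * g) = g"
      using g by (simp flip: mult.assoc)
    finally show ?thesis .
  qed
  have "x * g3 * y = qbar g3"
    using g d(1) by (simp add: x_def y_def mult.assoc) (simp flip: mult.assoc)
  moreover have "x \<noteq> 0" "y \<noteq> 0"
    using g d(1) qbar_eq_0 by (auto simp: x_def y_def)
  ultimately show "\<exists>x y. x \<noteq> 0 \<and> y \<noteq> 0 \<and> x * g1 * y = qbar g1 \<and> x * g2 * y = qbar g2 \<and> x * g3 * y = qbar g3"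
    using *[OF d(2)] *[OF d(3)] by blast
qed

end

section \<open>Compactness modulo a central cyclic subgroup\<close>

context local_field
begin

abbreviation K :: "'k topology" where
  "K \<equiv> av_topology av"

lemma av_zero [simp]: "av 0 = 0"
  by (simp add: av_eq_0_iff)

lemma av_one [simp]: "av 1 = 1"
  using av_mult[of 1 1] by (simp add: av_eq_0_iff)

lemma av_minus_one: "av (- 1) = 1"
proof -
  have "(av (- 1))\<^sup>2 = 1"
    by (simp add: power2_eq_square flip: av_mult)
  then show ?thesis
    using av_nonneg[of "- 1"] by (auto simp: power2_eq_1_iff)
qed

lemma av_minus [simp]: "av (- x) = av x"
  using av_mult[of "- 1" x] by (simp add: av_minus_one)

lemma av_pos: "x \<noteq> 0 \<Longrightarrow> 0 < av x"
  by (simp add: av_eq_0_iff av_nonneg order_less_le)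

lemma av_inverse: "av (inverse x) = inverse (av x)"
proof (cases "x = 0")
  case False
  then have "av x * av (inverse x) = 1"
    by (simp flip: av_mult)
  then show ?thesis
    by (simp add: inverse_unique)
qed simp

lemma av_power: "av (x ^ n) = av x ^ n"
  by (induction n) (simp_all add: av_mult)

sublocale metric: Metric_space UNIV "\<lambda>x y. av (x - y)"
proof
  show "0 \<le> av (x - y)" for x y by (rule av_nonneg)
  show "av (x - y) = av (y - x)" for x y
    using av_minus[of "x - y"] by simp
  show "av (x - y) = 0 \<longleftrightarrow> x = y" for x y
    by (simp add: av_eq_0_iff)
  show "av (x - z) \<le> av (x - y) + av (y - z)" for x y z
    using av_triangle[of "x - y" "y - z"] by simp
qed

lemma K_eq: "K = metric.mtopology"
  by (simp add: av_topology_def)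

lemma topspace_K [simp]: "topspace K = UNIV"
  by (simp add: K_eq)

section \<open>Continuity and compact balls in the base field\<close>

lemma continuous_map_K:
  "continuous_map Y K f \<longleftrightarrow>
    (\<forall>x\<in>topspace Y. \<forall>e>0. \<exists>U. openin Y U \<and> x \<in> U \<and> (\<forall>y\<in>U. av (f x - f y) < e))"
  unfolding K_eq metric.continuous_map_to_metric by simp

lemma continuous_map_K_add:
  assumes "continuous_map Y K f" "continuous_map Y K g"
  shows "continuous_map Y K (\<lambda>x. f x + g x)"
  unfolding continuous_map_K
proof (intro ballI allI impI)
  fix x and e :: real assume x: "x \<in> topspace Y" and e: "e > 0"
  obtain U where U: "openin Y U" "x \<in> U" "\<forall>y\<in>U. av (f x - f y) < e / 2"
    using assms(1) x e unfolding continuous_map_K by (metis half_gt_zero)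
  obtain V where V: "openin Y V" "x \<in> V" "\<forall>y\<in>V. av (g x - g y) < e / 2"
    using assms(2) x e unfolding continuous_map_K by (metis half_gt_zero)
  have "av (f x + g x - (f y + g y)) < e" if "y \<in> U \<inter> V" for y
  proof -
    have "av (f x + g x - (f y + g y)) \<le> av (f x - f y) + av (g x - g y)"
      using av_triangle[of "f x - f y" "g x - g y"] by (simp add: algebra_simps)
    moreover have "av (f x - f y) < e / 2" "av (g x - g y) < e / 2"
      using U V that by auto
    ultimately show ?thesis by linarith
  qed
  then show "\<exists>U. openin Y U \<and> x \<in> U \<and> (\<forall>y\<in>U. av (f x + g x - (f y + g y)) < e)"
    using U V by (intro exI[of _ "U \<inter> V"]) auto
qed

lemma continuous_map_K_mult_const:
  assumes "continuous_map Y K f"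
  shows "continuous_map Y K (\<lambda>x. f x * c)"
proof (cases "c = 0")
  case True
  then show ?thesis by (simp add: K_eq)
next
  case False
  show ?thesis
    unfolding continuous_map_K
  proof (intro ballI allI impI)
    fix x and e :: real assume x: "x \<in> topspace Y" and e: "e > 0"
    have c: "av c > 0" using False by (rule av_pos)
    then have "e / av c > 0" using e by simp
    then obtain U where U: "openin Y U" "x \<in> U" "\<forall>y\<in>U. av (f x - f y) < e / av c"
      using assms x unfolding continuous_map_K by meson
    have "av (f x * c - f y * c) < e" if "y \<in> U" for y
      using U(3) that c by (simp add: pos_less_divide_eq flip: left_diff_distrib av_mult)
    then show "\<exists>U. openin Y U \<and> x \<in> U \<and> (\<forall>y\<in>U. av (f x * c - f y * c) < e)"
      using U by blast
  qed
qed

lemma continuous_map_K_sum: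
  assumes "finite I" "\<And>i. i \<in> I \<Longrightarrow> continuous_map Y K (f i)"
  shows "continuous_map Y K (\<lambda>x. \<Sum>i\<in>I. f i x)"
  using assms
proof (induction I rule: finite_induct)
  case empty
  then show ?case by (simp add: K_eq)
next
  case (insert i I)
  then show ?case by (simp add: continuous_map_K_add)
qed

lemma ex_av_gt_1: "\<exists>x. av x > 1"
proof -
  obtain x where x: "x \<noteq> 0" "av x \<noteq> 1"
    using av_nontrivial by blast
  show ?thesis
  proof (cases "av x > 1")
    case False
    then have "av (inverse x) > 1"
      using x av_pos[of x] by (simp add: av_inverse one_less_inverse_iff)
    then show ?thesis by blast
  qed blast
qed

lemma ex_scalar: "\<exists>c :: 'k. c \<noteq> 0 \<and> c \<noteq> 1"
proof -
  obtain x where "x \<noteq> 0" "av x \<noteq> 1"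
    using av_nontrivial by blast
  then show ?thesis
    by (intro exI[of _ x]) auto
qed

lemma ex_uniformizer: "\<exists>c. 0 < av c \<and> av c < 1"
proof -
  obtain x where "av x > 1" using ex_av_gt_1 by blast
  then have "0 < av (inverse x) \<and> av (inverse x) < 1"
    by (auto simp: av_inverse inverse_less_1_iff)
  then show ?thesis by blast
qed

text \<open>Local compactness gives one small compact ball around 0; multiplication by a scalar of
  large absolute value is continuous and carries it over any given ball.\<close>

lemma compactin_ball: "compactin K {x. av x \<le> r}"
proof -
  have "\<exists>U C. openin K U \<and> compactin K C \<and> 0 \<in> U \<and> U \<subseteq> C"
    using locally_compact unfolding locally_compact_space_def by (rule bspec) simp
  then obtain U C where U: "openin K U" "compactin K C" "0 \<in> U" "U \<subseteq> C"
    by (elim exE conjE)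
  then obtain e where e: "e > 0" "metric.mball 0 e \<subseteq> U"
    unfolding K_eq metric.openin_mtopology by blast
  have sub: "metric.mcball 0 (e / 2) \<subseteq> C"
    using U e by (auto simp: subset_iff)
  have "compactin K (metric.mcball 0 (e / 2))"
    using closed_compactin[OF U(2) sub] metric.closedin_mcball by (simp add: K_eq)
  moreover have "metric.mcball 0 (e / 2) = {x. av x \<le> e / 2}"
    by (auto simp: metric.mcball_def)
  ultimately have small: "compactin K {x. av x \<le> e / 2}" by simp
  obtain x where "av x > 1" using ex_av_gt_1 by blast
  then obtain n where n: "r / (e / 2) < av x ^ n"
    using real_arch_pow by blast
  define b where "b = x ^ n"
  have b: "r / (e / 2) < av b" "0 < av b"
    using n \<open>av x > 1\<close> by (auto simp: b_def av_power)
  then have "b \<noteq> 0" by auto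
  have "continuous_map K K (\<lambda>x. x * b)"
    by (intro continuous_map_K_mult_const) simp
  then have "compactin K ((\<lambda>x. x * b) ` {x. av x \<le> e / 2})"
    using small image_compactin by blast
  moreover have "{x. av x \<le> r} \<subseteq> (\<lambda>x. x * b) ` {x. av x \<le> e / 2}"
  proof
    fix y assume y: "y \<in> {x. av x \<le> r}"
    have "av (y * inverse b) \<le> e / 2"
    proof -
      have "r < av b * (e / 2)"
        using b(1) e(1) by (simp only: pos_divide_less_eq half_gt_zero)
      then have "av y \<le> av b * (e / 2)" using y by simp
      then show ?thesis
        unfolding av_mult av_inverse using b(2) by (simp add: field_simps)
    qed
    moreover have "y = y * inverse b * b"
      using \<open>b \<noteq> 0\<close> by simp
    ultimately show "y \<in> (\<lambda>x. x * b) ` {x. av x \<le> e / 2}" by blast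
  qed
  moreover have "closedin K {x. av x \<le> r}"
  proof -
    have "{x. av x \<le> r} = metric.mcball 0 r"
      by (auto simp: metric.mcball_def)
    then show ?thesis using metric.closedin_mcball[of 0 r] by (simp add: K_eq)
  qed
  ultimately show ?thesis
    by (rule closed_compactin)
qed

lemma openin_small: "openin K {x. av x < r}"
proof -
  have "{x. av x < r} = metric.mball 0 r"
    by (auto simp: metric.mball_def)
  then show ?thesis using metric.openin_mball[of 0 r] by (simp add: K_eq)
qed

lemma closedin_large: "closedin K {x. r \<le> av x}"
proof -
  have "{x. r \<le> av x} = UNIV - {x. av x < r}" by auto
  then show ?thesis
    using openin_small[of r] by (simp add: closedin_def Compl_eq_Diff_UNIV[symmetric] double_complement)
qed

end

section \<open>Topology of the algebra through coordinates\<close>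

locale local_quaternion_algebra = local_field av + quaternion_division_algebra scaleD
  for av :: "'k::field \<Rightarrow> real" and scaleD :: "'k \<Rightarrow> 'd::division_ring \<Rightarrow> 'd"
begin

sublocale quaternion_division_algebra_big scaleD
  by unfold_locales (rule ex_scalar)

text \<open>The same choice term as in \<open>natural_topology\<close>, so that the topology is the
  one of these coordinates.\<close>

definition basis :: "'d set" where
  "basis = (SOME B. independent B \<and> span B = UNIV)"

lemma basis: "independent basis" "span basis = UNIV" "finite basis"
proof -
  obtain B where B: "finite B" "independent B" "span B = UNIV" "card B = 4"
    by (rule finite_basis)
  interpret finite_dimensional_vector_space scaleD B
    using B by unfold_locales auto
  have "independent basis \<and> span basis = UNIV"
    unfolding basis_def by (rule someI[of _ B]) (use B in auto)
  then show "independent basis" "span basis = UNIV" "finite basis"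
    using finiteI_independent by auto
qed

lemma basis_nonempty: "basis \<noteq> {}"
proof
  assume "basis = {}"
  then have "1 \<in> span {}"
    using basis(2) by simp
  then show False by simp
qed

definition coord :: "'d \<Rightarrow> 'd \<Rightarrow> 'k" where
  "coord b x = representation basis x b"

abbreviation D :: "'d topology" where
  "D \<equiv> natural_topology K scaleD"

lemma D_eq: "D = pullback_topology UNIV (\<lambda>x. \<lambda>b\<in>basis. coord b x) (product_topology (\<lambda>_. K) basis)"
  unfolding natural_topology_def basis_def[symmetric] coord_def Let_def ..

lemma topspace_D [simp]: "topspace D = UNIV"
  by (auto simp: D_eq topspace_pullback_topology)

lemma coord_scaleD: "coord b (scaleD c x) = c * coord b x"
  by (simp add: coord_def representation_scale basis)

lemma coord_sum: "coord b (\<Sum>i\<in>I. f i) = (\<Sum>i\<in>I. coord b (f i))"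
  by (simp add: coord_def representation_sum basis)

lemma coord_basis: "c \<in> basis \<Longrightarrow> coord b c = (if b = c then 1 else 0)"
  by (simp add: coord_def representation_basis basis)

lemma sum_coord: "(\<Sum>b\<in>basis. scaleD (coord b x) b) = x"
  unfolding coord_def by (rule sum_representation_eq) (auto simp: basis)

lemma continuous_map_coord:
  assumes "b \<in> basis"
  shows "continuous_map D K (coord b)"
proof -
  have "continuous_map D K ((\<lambda>f. f b) \<circ> (\<lambda>x. \<lambda>b\<in>basis. coord b x))"
    unfolding D_eq using assms by (intro continuous_map_pullback continuous_map_product_projection)
  then show ?thesis
    using assms by (simp add: comp_def)
qed

lemma continuous_map_into_D:
  assumes "\<And>b. b \<in> basis \<Longrightarrow> continuous_map Y K (\<lambda>x. coord b (h x))"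
  shows "continuous_map Y D h"
  unfolding D_eq
  by (rule continuous_map_pullback') (auto simp: comp_def continuous_map_componentwise intro: assms)

lemma continuous_map_mult_left: "continuous_map D D (\<lambda>x. g * x)"
proof (rule continuous_map_into_D)
  fix b
  have eq: "coord b (g * x) = (\<Sum>c\<in>basis. coord c x * coord b (g * c))" for x
  proof -
    have "g * x = (\<Sum>c\<in>basis. scaleD (coord c x) (g * c))"
      using sum_coord[of x] by (metis (no_types, lifting) scale_mult_right sum.cong sum_distrib_left)
    then show ?thesis
      by (simp add: coord_sum coord_scaleD)
  qed
  show "continuous_map D K (\<lambda>x. coord b (g * x))"
    by (subst ext[of "\<lambda>x. coord b (g * x)", OF eq])
      (intro continuous_map_K_sum continuous_map_K_mult_const continuous_map_coord basis(3))
qed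

lemma compactin_box: "compactin D {x. \<forall>b\<in>basis. av (coord b x) \<le> r}"
proof -
  let ?s = "\<lambda>f. \<Sum>b\<in>basis. scaleD (f b) b"
  have s: "coord b (?s f) = f b" if "b \<in> basis" for b f
    using that basis
    by (simp add: coord_sum coord_scaleD coord_basis if_distrib[of "\<lambda>x. _ * x"] cong: if_cong)
  have "compactin (product_topology (\<lambda>_. K) basis) (\<Pi>\<^sub>E b\<in>basis. {x. av x \<le> r})"
    by (simp add: compactin_PiE compactin_ball)
  moreover have "continuous_map (product_topology (\<lambda>_. K) basis) D ?s"
  proof (rule continuous_map_into_D)
    fix b assume b: "b \<in> basis"
    have "continuous_map (product_topology (\<lambda>_. K) basis) ((\<lambda>_. K) b) (\<lambda>x. x b)"
      using b by (rule continuous_map_product_projection)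
    then show "continuous_map (product_topology (\<lambda>_. K) basis) K (\<lambda>f. coord b (?s f))"
      using b by (simp add: s)
  qed
  ultimately have "compactin D (?s ` (\<Pi>\<^sub>E b\<in>basis. {x. av x \<le> r}))"
    by (rule image_compactin)
  also have "?s ` (\<Pi>\<^sub>E b\<in>basis. {x. av x \<le> r}) = {x. \<forall>b\<in>basis. av (coord b x) \<le> r}"
  proof safe
    fix f b assume "f \<in> (\<Pi>\<^sub>E b\<in>basis. {x. av x \<le> r})" "b \<in> basis"
    then show "av (coord b (?s f)) \<le> r"
      using s by (auto simp: PiE_iff)
  next
    fix x assume x: "\<forall>b\<in>basis. av (coord b x) \<le> r"
    have "x = ?s (\<lambda>b\<in>basis. coord b x)"
      by (simp add: sum_coord)
    moreover have "(\<lambda>b\<in>basis. coord b x) \<in> (\<Pi>\<^sub>E b\<in>basis. {x. av x \<le> r})"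
      using x by auto
    ultimately show "x \<in> ?s ` (\<Pi>\<^sub>E b\<in>basis. {x. av x \<le> r})"
      by (rule image_eqI)
  qed
  finally show ?thesis .
qed

text \<open>For \<open>q = av p\<close> with \<open>0 < q < 1\<close>, a compact set without 0 that
  meets every orbit of scaling by powers of \<open>p\<close> on nonzero elements.\<close>

definition annulus :: "real \<Rightarrow> 'd set" where
  "annulus q = {x. (\<forall>b\<in>basis. av (coord b x) \<le> 1) \<and> (\<exists>b\<in>basis. q \<le> av (coord b x))}"

lemma compactin_annulus: "compactin D (annulus q)"
proof (rule closed_compactin[OF compactin_box])
  show "annulus q \<subseteq> {x. \<forall>b\<in>basis. av (coord b x) \<le> 1}"
    by (auto simp: annulus_def)
  have 1: "closedin D {x. \<forall>b\<in>basis. av (coord b x) \<le> 1}"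
  proof -
    have "closedin D {x \<in> topspace D. coord b x \<in> {x. av x \<le> 1}}" if "b \<in> basis" for b
    proof (rule closedin_continuous_map_preimage[OF continuous_map_coord[OF that]])
      have "{x. av x \<le> 1} = metric.mcball 0 1"
        by (auto simp: metric.mcball_def)
      then show "closedin K {x. av x \<le> 1}"
        using metric.closedin_mcball[of 0 1] by (simp add: K_eq)
    qed
    then have "closedin D (\<Inter>b\<in>basis. {x. av (coord b x) \<le> 1})"
      using basis_nonempty by (intro closedin_INT) auto
    then show ?thesis
      by (simp add: INTER_eq)
  qed
  have 2: "closedin D (\<Union>b\<in>basis. {x. q \<le> av (coord b x)})"
  proof (rule closedin_Union)
    show "finite ((\<lambda>b. {x. q \<le> av (coord b x)}) ` basis)"
      using basis by simp
    fix S assume "S \<in> (\<lambda>b. {x. q \<le> av (coord b x)}) ` basis"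
    then obtain b where b: "b \<in> basis" "S = {x \<in> topspace D. coord b x \<in> {x. q \<le> av x}}"
      by auto
    show "closedin D S"
      unfolding b(2) by (rule closedin_continuous_map_preimage[OF continuous_map_coord[OF b(1)] closedin_large])
  qed
  have "annulus q = {x. \<forall>b\<in>basis. av (coord b x) \<le> 1} \<inter> (\<Union>b\<in>basis. {x. q \<le> av (coord b x)})"
    by (auto simp: annulus_def)
  then show "closedin D (annulus q)"
    using closedin_Int[OF 1 2] by simp
qed

text \<open>The maximum norm of the coordinates scales by \<open>av\<close>, and this homogeneity
  suffices; no multiplicative norm on the algebra is involved. The factor \<open>p ^ n\<close> first
  brings the norm below 1, so that only natural powers occur afterwards.\<close>

lemma ex_scaled_in_annulus:
  assumes q: "av p = q" "0 < q" "q < 1" and "x \<noteq> 0"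
  shows "\<exists>n m. \<exists>y\<in>annulus q. scaleD (p ^ n) x = scaleD (p ^ m) y"
proof -
  have "p \<noteq> 0" using q by auto
  define N where "N x = Max ((\<lambda>b. av (coord b x)) ` basis)" for x
  have N_ge: "av (coord b x) \<le> N x" if "b \<in> basis" for b x
    unfolding N_def using basis that by (intro Max_ge) auto
  have N_ex: "\<exists>b\<in>basis. av (coord b x) = N x" for x
  proof -
    have "N x \<in> (\<lambda>b. av (coord b x)) ` basis"
      unfolding N_def using basis basis_nonempty by (intro Max_in) auto
    then show ?thesis by auto
  qed
  have N_scale: "N (scaleD c x) = av c * N x" for c x
  proof (rule antisym)
    obtain b where b: "b \<in> basis" "av (coord b (scaleD c x)) = N (scaleD c x)"
      using N_ex by blast
    then show "N (scaleD c x) \<le> av c * N x"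
      using N_ge[of b x] av_nonneg[of c] mult_left_mono[of "av (coord b x)" "N x" "av c"]
      by (simp add: coord_scaleD av_mult)
    obtain b' where b': "b' \<in> basis" "av (coord b' x) = N x"
      using N_ex by blast
    show "av c * N x \<le> N (scaleD c x)"
      using N_ge[OF b'(1), of "scaleD c x"] b'(2) by (simp add: coord_scaleD av_mult)
  qed
  have "N x > 0"
  proof (rule ccontr)
    assume "\<not> N x > 0"
    then have "coord b x = 0" if "b \<in> basis" for b
      using N_ge[OF that, of x] av_nonneg[of "coord b x"] by (simp add: av_eq_0_iff[symmetric])
    then have "x = 0"
      using sum_coord[of x] by simp
    with \<open>x \<noteq> 0\<close> show False ..
  qed
  obtain n where n: "q ^ n < inverse (N x)"
    using q \<open>N x > 0\<close> real_arch_pow_inv[of "inverse (N x)" q] by auto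
  define w where "w = scaleD (p ^ n) x"
  have Nw: "N w = q ^ n * N x"
    using q by (simp add: w_def N_scale av_power)
  then have "N w \<le> 1" "0 < N w"
    using n q \<open>N x > 0\<close> by (auto simp: field_simps)
  obtain j0 where "q ^ j0 < N w"
    using q \<open>0 < N w\<close> real_arch_pow_inv by blast
  then have j0: "q ^ Suc j0 < N w"
    using q by (smt (verit) mult_le_cancel_right2 power_Suc zero_less_power)
  \<comment> \<open>Minimality gives \<open>q ^ Suc j < N w \<le> q ^ j\<close>, where the case
    \<open>j = 0\<close> is \<open>N w \<le> 1\<close>; division by \<open>p ^ j\<close> then puts
    the norm between \<open>q\<close> and 1.\<close>
  define j where "j = (LEAST j. q ^ Suc j < N w)"
  have j: "q ^ Suc j < N w"
    unfolding j_def using j0 by (rule LeastI)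
  have j': "N w \<le> q ^ j"
  proof (cases j)
    case 0
    then show ?thesis using \<open>N w \<le> 1\<close> by simp
  next
    case (Suc i)
    then have "\<not> q ^ Suc i < N w"
      unfolding j_def by (intro not_less_Least) simp
    then show ?thesis using Suc by simp
  qed
  define y where "y = scaleD (inverse (p ^ j)) w"
  have "N y = N w / q ^ j"
    unfolding y_def N_scale av_inverse av_power q(1) by (simp add: divide_inverse)
  then have "N y \<le> 1" "q \<le> N y"
    using j j' zero_less_power[OF q(2), of j]
    by (simp_all only: divide_le_eq_1_pos pos_le_divide_eq power_Suc less_imp_le)
  moreover obtain b where b: "b \<in> basis" "av (coord b y) = N y"
    using N_ex by blast
  ultimately have "\<forall>b\<in>basis. av (coord b y) \<le> 1" "\<exists>b\<in>basis. q \<le> av (coord b y)"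
    using order_trans[OF N_ge[of _ y]] by (blast, metis)
  then have "y \<in> annulus q"
    by (simp add: annulus_def)
  moreover have "scaleD (p ^ j) y = w"
    using \<open>p \<noteq> 0\<close> by (simp add: y_def)
  ultimately have "scaleD (p ^ n) x = scaleD (p ^ j) y" "y \<in> annulus q"
    by (simp_all add: w_def)
  then show ?thesis
    by (intro exI bexI)
qed

text \<open>The translates \<open>g V\<close> of an open neighbourhood of 1, with \<open>g\<close>
  in the compact annulus, cover it; a finite subcover supplies \<open>S\<close>, and powers of the
  central element \<open>z\<close> move every nonzero \<open>g\<close> into the annulus.\<close>

lemma cocompact:
  assumes U: "openin (mult_group_topology av scaleD) U" and "1 \<in> U"
  shows "\<exists>z S. z \<noteq> 0 \<and> (\<forall>g. z * g = g * z) \<and> finite S \<and> 0 \<notin> S \<and>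
    (\<forall>g. g \<noteq> 0 \<longrightarrow> (\<exists>n m s u. s \<in> S \<and> u \<in> U \<and> z ^ n * g = z ^ m * s * u))"
proof -
  obtain V where V: "openin D V" "U = V \<inter> {x. x \<noteq> 0}"
    using U unfolding mult_group_topology_def openin_subtopology by auto
  obtain p where p: "0 < av p" "av p < 1"
    using ex_uniformizer by blast
  then have "p \<noteq> 0" by auto
  define A where "A = annulus (av p)"
  have A0: "0 \<notin> A"
    using p coord_scaleD[of _ 0 0] by (auto simp: A_def annulus_def)
  \<comment> \<open>\<open>V\<close> is open in the whole algebra and may contain 0; the elements
    \<open>inverse s * y\<close> used below are nonzero and so lie in \<open>U\<close>.\<close>
  define coset where "coset g = {x. inverse g * x \<in> V}" for g
  have open_coset: "openin D (coset g)" for g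
    using openin_continuous_map_preimage[OF continuous_map_mult_left V(1), of "inverse g"]
    by (simp add: coset_def)
  have "x \<in> coset x" if "x \<in> A" for x
  proof -
    have "x \<noteq> 0" using that A0 by auto
    then show ?thesis
      using \<open>1 \<in> U\<close> V(2) by (simp add: coset_def)
  qed
  then have "A \<subseteq> \<Union>(coset ` A)"
    by blast
  then obtain F where "finite F" "F \<subseteq> coset ` A" "A \<subseteq> \<Union>F"
    using compactinD[OF compactin_annulus[of "av p"], of "coset ` A"] open_coset
    unfolding A_def[symmetric] by blast
  then obtain S where S: "finite S" "S \<subseteq> A" "A \<subseteq> \<Union>(coset ` S)"
    by (metis finite_subset_image)
  define z where "z = scaleD p 1"
  have z_pow: "z ^ n = scaleD (p ^ n) 1" for n
    by (induction n) (simp_all add: z_def scale_mult_left mult.commute)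
  have "\<exists>n m s u. s \<in> S \<and> u \<in> U \<and> z ^ n * g = z ^ m * s * u" if g: "g \<noteq> 0" for g
  proof -
    obtain n m y where y: "y \<in> A" "scaleD (p ^ n) g = scaleD (p ^ m) y"
      using ex_scaled_in_annulus[OF refl p g] unfolding A_def by blast
    then obtain s where s: "s \<in> S" "y \<in> coset s"
      using S by blast
    have "s \<noteq> 0" "y \<noteq> 0"
      using s y S A0 by auto
    then have "inverse s * y \<in> U"
      using s V(2) by (simp add: coset_def)
    moreover have "z ^ n * g = z ^ m * s * (inverse s * y)"
    proof -
      have "s * (inverse s * y) = y"
        using \<open>s \<noteq> 0\<close> by (simp flip: mult.assoc)
      then show ?thesis
        using y(2) by (simp add: z_pow scale_mult_left)
    qed
    ultimately show ?thesis using s by blast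
  qed
  moreover have "z \<noteq> 0"
    using \<open>p \<noteq> 0\<close> by (simp add: z_def)
  moreover have "z * g = g * z" for g
    by (simp add: z_def scale_mult_left scale_mult_right)
  moreover have "0 \<notin> S"
    using S A0 by blast
  ultimately show ?thesis
    using S(1) by blast
qed

text \<open>Smoothness is applied to one nonzero vector: its stabilizer is the open set
  \<open>U\<close> for \<open>cocompact\<close>.\<close>

lemma smooth_irreducible_fd_rep:
  fixes scale :: "'f::alg_closed_field \<Rightarrow> 'v::ab_group_add \<Rightarrow> 'v"
  assumes irred: "irreducible_mult_group_rep scale \<rho>"
    and smooth: "smooth_rep (mult_group_topology av scaleD) \<rho>"
  shows "fd_rep_involution scale \<rho> qbar"
proof -
  interpret R: irreducible_rep_alg_closed scale \<rho>
    using irred by (rule irreducible_rep_alg_closed.intro)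
  obtain v :: 'v where v: "v \<noteq> 0"
    using R.nontrivial by blast
  let ?U = "{g. g \<noteq> 0 \<and> \<rho> g v = v}"
  have "openin (mult_group_topology av scaleD) ?U"
    using smooth by (simp add: smooth_rep_def)
  moreover have "1 \<in> ?U"
    by (simp add: R.rep_one)
  ultimately obtain z S where z: "z \<noteq> 0" "\<And>g. z * g = g * z" and S: "finite S" "0 \<notin> S"
    and cover: "\<And>g. g \<noteq> 0 \<Longrightarrow> \<exists>n m s u. s \<in> S \<and> u \<in> ?U \<and> z ^ n * g = z ^ m * s * u"
    using cocompact[of ?U] by auto
  have "\<exists>S. finite S \<and> R.span S = UNIV"
    using cover by (intro R.finite_dimensional_of_cocompact[OF z S v]) blast
  then have "fd_irreducible_rep scale \<rho>"
    by (intro fd_irreducible_rep.intro fd_irreducible_rep_axioms.intro R.irreducible_rep_alg_closed_axioms)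
  then show ?thesis
    by (intro fd_rep_involution.intro conjugating_involution_qbar)
qed

end

theorem corollary1p10:
  fixes av :: "'k::field \<Rightarrow> real"
    and scaleD :: "'k \<Rightarrow> 'd::division_ring \<Rightarrow> 'd"
    and s1 :: "'l::prime_card mod_ring alg_closure \<Rightarrow> 'u::ab_group_add \<Rightarrow> 'u"
    and s2 :: "'l mod_ring alg_closure \<Rightarrow> 'v::ab_group_add \<Rightarrow> 'v"
    and s3 :: "'l mod_ring alg_closure \<Rightarrow> 'w::ab_group_add \<Rightarrow> 'w"
    and \<rho>1 :: "'d \<Rightarrow> 'u \<Rightarrow> 'u"
    and \<rho>2 :: "'d \<Rightarrow> 'v \<Rightarrow> 'v"
    and \<rho>3 :: "'d \<Rightarrow> 'w \<Rightarrow> 'w"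
  assumes "local_field av"
    and "quaternion_division_algebra scaleD"
    and "irreducible_mult_group_rep s1 \<rho>1" and "smooth_rep (mult_group_topology av scaleD) \<rho>1"
    and "irreducible_mult_group_rep s2 \<rho>2" and "smooth_rep (mult_group_topology av scaleD) \<rho>2"
    and "irreducible_mult_group_rep s3 \<rho>3" and "smooth_rep (mult_group_topology av scaleD) \<rho>3"
  shows "(\<exists>B. finite B \<and>
             tensor3.invariant_forms s1 s2 s3 \<rho>1 \<rho>2 \<rho>3 \<subseteq> Modules.module.span form_scale B) \<and>
         vector_space.dim form_scale (tensor3.invariant_forms s1 s2 s3 \<rho>1 \<rho>2 \<rho>3) \<le> 1"
proof -
  interpret local_field av
    by fact
  interpret quaternion_division_algebra scaleD
    by fact
  interpret local_quaternion_algebra av scaleD ..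
  interpret three_fd_reps_involution s1 \<rho>1 s2 \<rho>2 s3 \<rho>3 qbar
    using assms(3-8) by (intro three_fd_reps_involution.intro smooth_irreducible_fd_rep)
  show ?thesis
    by (rule invariant_forms_dim_le_1)
qed

end
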